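(* Suppose that $(\widetilde\Sigma_0,\widetilde\mu_0)$, $(\Sigma_0,\mu_0),(\Sigma_1,\mu_1),\ldots,(\Sigma_m,\mu_m)$ are measure spaces, and $\mathscr{S}_j$ is the collection of all simple functions on $\Sigma_j$, $j=1,\ldots,m$. Denote by $\mathfrak{M}(\widetilde\Sigma_0\times\Sigma_0)$ the set of all measurable functions on $\widetilde\Sigma_0\times\Sigma_0$. Let $T:\mathscr{S}=\mathscr{S}_1\times\cdots\times\mathscr{S}_m\to\mathfrak{M}(\widetilde\Sigma_0\times\Sigma_0)$ be an $m$-linear operator; write $T(\vec f)(x,y)$ with $x\in\Sigma_0$, $y\in\widetilde\Sigma_0$. Let $0<\widetilde p_0,\widetilde q_0,p_0,q_0<\infty$, $1\le p_j,q_j\le\infty$ $(j=1,\ldots,m)$, let $w_j,v_j$ be weights on $\Sigma_j$ $(j=1,\ldots,m)$, and let $w_0,v_0$ be weights on $\Sigma_0$. Assume that there exist $M_1,M_2\in(0,\infty)$ such that $$\bigg[\int_{\Sigma_0}\bigg(\int_{\widetilde\Sigma_0}|T(\vec f)(x,y)|^{\widetilde p_0}d\widetilde\mu_0(y)\bigg)^{\frac{p_0}{\widetilde p_0}}w_0(x)^{p_0}d\mu_0(x)\bigg]^{\frac1{p_0}}\le M_1\prod_{j=1}^m\|f_j\|_{L^{p_j}(\Sigma_j,w_j^{p_j})}$$ for all $\vec f=(f_1,\ldots,f_m)\in\mathscr{S}$ with $\|f_jw_j\|_{L^{p_j}(\Sigma_j,\mu_j)}<\infty$, $j=1,\ldots,m$,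 and $$\bigg[\int_{\Sigma_0}\bigg(\int_{\widetilde\Sigma_0}|T(\vec f)(x,y)|^{\widetilde q_0}d\widetilde\mu_0(y)\bigg)^{\frac{q_0}{\widetilde q_0}}v_0(x)^{q_0}d\mu_0(x)\bigg]^{\frac1{q_0}}\le M_2\prod_{j=1}^m\|f_j\|_{L^{q_j}(\Sigma_j,v_j^{q_j})}$$ for all $\vec f=(f_1,\ldots,f_m)\in\mathscr{S}$ with $\|f_jv_j\|_{L^{q_j}(\Sigma_j,\mu_j)}<\infty$, $j=1,\ldots,m$. Then, for all exponents and weights satisfying $0<\theta<1$ and $$\frac1{\widetilde r_0}=\frac{1-\theta}{\widetilde p_0}+\frac{\theta}{\widetilde q_0},\quad \frac1{r_j}=\frac{1-\theta}{p_j}+\frac{\theta}{q_j},\quad u_j=w_j^{1-\theta}v_j^\theta,\quad j=0,\ldots,m,$$ we have $$\bigg[\int_{\Sigma_0}\bigg(\int_{\widetilde\Sigma_0}|T(\vec f)(x,y)|^{\widetilde r_0}d\widetilde\mu_0(y)\bigg)^{\frac{r_0}{\widetilde r_0}}u_0(x)^{r_0}d\mu_0(x)\bigg]^{\frac1{r_0}}\le M_1^{1-\theta}M_2^\theta\prod_{j=1}^m\|f_j\|_{L^{r_j}(\Sigma_j,u_j^{r_j})}$$ for all $\vec f=(f_1,\ldots,f_m)\in\mathscr{S}$ with $\|f_jw_j\|_{L^{p_j}(\Sigma_j,\mu_j)}<\infty$ and $\|f_jv_j\|_{L^{q_j}(\Sigma_j,\mu_j)}<\infty$, $j=1,\ld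ots,m$.
   Context: A weight on a measure space $(\Sigma,\mu)$ is a measurable function $w$ with $0<w<\infty$ $\mu$-a.e. A simple function is a finite linear combination of indicator functions of measurable sets of finite measure. $\|f\|_{L^p(\Sigma,w^p)}=\|fw\|_{L^p(\Sigma,\mu)}$ (also used as the definition when $p=\infty$).
   Formalization: The inner integrals over Σ̃₀ in the two assumed estimates are required to be measurable in x, so that the outer integrals make sense; this is automatic for σ-finite Σ̃₀ but can fail for arbitrary measure spaces. *)

theory Defs
  imports "HOL-Probability.Essential_Supremum"
begin

text \<open>
  Powers \<open>x\<^sup>a\<close> of a value in \<open>[0,\<infinity>]\<close>. Only exponents \<open>a > 0\<close> are ever used, with
  \<open>0\<^sup>a = 0\<close> and \<open>\<infinity>\<^sup>a = \<infinity>\<close>.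
\<close>

definition epowr :: "ennreal \<Rightarrow> real \<Rightarrow> ennreal" where
  "epowr x a = (if x = \<infinity> then \<infinity> else ennreal (enn2real x powr a))"

definition weight :: "'a measure \<Rightarrow> ('a \<Rightarrow> ennreal) \<Rightarrow> bool" where
  "weight M w \<longleftrightarrow> w \<in> borel_measurable M \<and> (AE x in M. 0 < w x \<and> w x < \<infinity>)"

text \<open>
  Since \<open>E k \<subseteq> space M\<close>, the functions below vanish off \<open>space M\<close>; two of them are equal as soon
  as they agree on \<open>space M\<close>.
\<close>

definition simple_fns :: "'a measure \<Rightarrow> ('a \<Rightarrow> complex) set" where
  "simple_fns M = {f. \<exists>(n::nat) (c :: nat \<Rightarrow> complex) E.
     (\<forall>k<n. E k \<in> sets M \<and> emeasure M (E k) < \<infinity>) \<and> f = (\<lambda>x. \<Sum>k<n. c k * indicator (E k) x)}"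

text \<open>
  The product \<open>S\<^sub>1 \<times> \<dots> \<times> S\<^sub>m\<close>: extensional families indexed by \<open>{1..m}\<close>, so that a family carries
  no information besides its \<open>m\<close> components.
\<close>

definition simple_tuples :: "nat \<Rightarrow> (nat \<Rightarrow> 'a measure) \<Rightarrow> (nat \<Rightarrow> 'a \<Rightarrow> complex) set" where
  "simple_tuples m M = (\<Pi>\<^sub>E j\<in>{1..m}. simple_fns (M j))"

definition multilinear_op ::
  "nat \<Rightarrow> (nat \<Rightarrow> 'a measure) \<Rightarrow> 'b measure \<Rightarrow> ((nat \<Rightarrow> 'a \<Rightarrow> complex) \<Rightarrow> 'b \<Rightarrow> complex) \<Rightarrow> bool" where
  "multilinear_op m M P T \<longleftrightarrow>
     (\<forall>f \<in> simple_tuples m M. T f \<in> borel_measurable P) \<and>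
     (\<forall>f \<in> simple_tuples m M. \<forall>j\<in>{1..m}. \<forall>g \<in> simple_fns (M j). \<forall>h \<in> simple_fns (M j). \<forall>a b.
        \<forall>z\<in>space P. T (f(j := \<lambda>x. a * g x + b * h x)) z = a * T (f(j := g)) z + b * T (f(j := h)) z)"

text \<open>
  The norm of \<open>f\<close> in \<open>L\<^sup>p(w\<^sup>p)\<close>, defined as the \<open>L\<^sup>p(M)\<close> norm of \<open>f w\<close>, also for \<open>p = \<infinity>\<close>.
\<close>

definition Lp_norm :: "'a measure \<Rightarrow> ennreal \<Rightarrow> ('a \<Rightarrow> ennreal) \<Rightarrow> ('a \<Rightarrow> complex) \<Rightarrow> ennreal" where
  "Lp_norm M p w f =
     (if p = \<infinity> then esssup M (\<lambda>x. ennreal (norm (f x)) * w x)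
      else epowr (\<integral>\<^sup>+x. epowr (ennreal (norm (f x)) * w x) (enn2real p) \<partial>M) (1 / enn2real p))"

text \<open>
  If \<open>Nt\<close> is not sigma-finite, \<open>inner_int Nt s F\<close> may fail to be measurable even for measurable \<open>F\<close>;
  the outer integral in \<open>mixed_norm\<close> is then only a lower integral.
\<close>

definition inner_int :: "'c measure \<Rightarrow> real \<Rightarrow> ('b \<times> 'c \<Rightarrow> complex) \<Rightarrow> 'b \<Rightarrow> ennreal" where
  "inner_int Nt s F x = (\<integral>\<^sup>+y. ennreal (norm (F (x, y)) powr s) \<partial>Nt)"

definition mixed_norm ::
  "'b measure \<Rightarrow> 'c measure \<Rightarrow> real \<Rightarrow> real \<Rightarrow> ('b \<Rightarrow> ennreal) \<Rightarrow> ('b \<times> 'c \<Rightarrow> complex) \<Rightarrow> ennreal" where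
  "mixed_norm N Nt s st w F =
     epowr (\<integral>\<^sup>+x. epowr (inner_int Nt st F x) (s / st) * epowr (w x) s \<partial>N) (1 / s)"

end

theory Submission
  imports Defs "HOL-Complex_Analysis.Complex_Analysis" "HOL-Real_Asymp.Real_Asymp"
begin

text \<open>
  The proof is the complex method, with every mean over the boundary of the strip taken over finitely many points.

  For real simple functions \<open>b\<^sub>j\<close> consider \<open>f\<^sub>j\<^sup>z = f\<^sub>j * exp (b\<^sub>j * (z - \<theta>))\<close>, again simple functions. By
  multilinearity, \<open>T (f\<^sup>z) (x, y)\<close> is for each point a finite sum of exponentials in \<open>z\<close> with real
  frequencies, hence entire and bounded on the strip \<open>0 \<le> Re z \<le> 1\<close>
  (\<open>strip_bounded_multilinear_exp_family\<close>), and at \<open>z = \<theta>\<close> it equals \<open>T f (x, y)\<close>. The \<open>b\<^sub>j\<close> can be chosen such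
  that the norm of \<open>f\<^sub>j\<^sup>z\<close> in \<open>L\<^sup>p(w\<^sup>p)\<close> on the line \<open>Re z = 0\<close> and its norm in \<open>L\<^sup>q(v\<^sup>q)\<close> on the line \<open>Re z = 1\<close>
  are both at most the norm of \<open>f\<^sub>j\<close> in \<open>L\<^sup>r(u\<^sup>r)\<close> plus \<open>\<eta>\<close> (\<open>balancing_exponent\<close>). The assumed bounds thus
  control \<open>T (f\<^sup>z)\<close> in mixed norm on the two lines, and a three lines theorem for mixed norms
  (\<open>three_lines_mixed_norm\<close>) gives the claim up to \<open>\<eta>\<close>.

  As the target exponents may be smaller than \<open>1\<close>, the three lines theorem is first proved pointwise. For
  an entire function \<open>h\<close> that is bounded on the strip, subharmonicity of \<open>log |h|\<close> bounds \<open>|h \<theta>|\<close> by the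
  \<open>(1 - \<theta>)\<close>-th power of a power mean of \<open>|h|\<close> over the left line times the \<open>\<theta>\<close>-th power of one over the right
  line. The means are taken over finitely many points, the conformal images of the \<open>N\<close>-th roots of
  unity, and \<open>N\<close> tends to infinity (\<open>strip_power_mean_liminf\<close>). Such a bound passes through a Lebesgue
  quasi-norm by Fatou, Hoelder and Minkowski, provided that the exponents of the power means do not exceed
  that of the norm (\<open>qnorm_interpolation_step\<close>). This is done in \<open>y\<close> at fixed \<open>x\<close> and then in \<open>x\<close>. Since only
  finite sums are involved, the measures may be arbitrary, and the only inner norms whose measurability
  is used are those of \<open>T (f\<^sup>z)\<close> on the two lines.
\<close>

section \<open>Powers and Lebesgue quasi-norms of extended nonnegative functions\<close>

lemma epowr_ennreal: "0 \<le> x \<Longrightarrow> epowr (ennreal x) a = ennreal (x powr a)"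
  by (simp add: epowr_def)

lemma epowr_0 [simp]: "epowr 0 a = 0"
  by (simp add: epowr_def)

lemma epowr_top [simp]: "epowr \<infinity> a = \<infinity>" "epowr top a = top"
  by (simp_all add: epowr_def)

lemma epowr_1 [simp]: "epowr x 1 = x"
  by (cases x) (simp_all add: epowr_def)

lemma epowr_mono: "0 \<le> a \<Longrightarrow> x \<le> y \<Longrightarrow> epowr x a \<le> epowr y a"
  by (cases x; cases y) (auto simp: epowr_def top_unique intro!: powr_mono2)

lemma epowr_mult: "epowr (x * y) a = epowr x a * epowr y a"
proof (cases "x = top \<or> y = top")
  case True
  then show ?thesis
    by (cases x; cases y) (auto simp: epowr_def ennreal_mult_top ennreal_top_mult)
next
  case False
  then obtain x' y' where xy: "x = ennreal x'" "0 \<le> x'" "y = ennreal y'" "0 \<le> y'"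
    by (metis ennreal_cases infinity_ennreal_def)
  then show ?thesis
    by (simp add: epowr_ennreal powr_mult flip: ennreal_mult)
qed

lemma epowr_epowr: "epowr (epowr x a) b = epowr x (a * b)"
  by (cases x) (auto simp: epowr_def powr_powr)

lemma epowr_add: "epowr x (a + b) = epowr x a * epowr x b"
  by (cases x) (auto simp: epowr_def powr_add ennreal_mult ennreal_top_mult)

lemma epowr_inverse: "a \<noteq> 0 \<Longrightarrow> epowr (epowr x a) (1 / a) = x" "a \<noteq> 0 \<Longrightarrow> epowr (epowr x (1 / a)) a = x"
  by (simp_all add: epowr_epowr)

lemma epowr_le_iff: "0 < a \<Longrightarrow> epowr x a \<le> epowr y a \<longleftrightarrow> x \<le> y"
  using epowr_mono[of a x y] epowr_mono[of "1 / a" "epowr x a" "epowr y a"] by (auto simp: epowr_inverse)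

lemma epowr_less_iff: "0 < a \<Longrightarrow> epowr x a < epowr y a \<longleftrightarrow> x < y"
  by (meson epowr_le_iff not_less)

lemma epowr_eq_0_iff: "epowr x a = 0 \<longleftrightarrow> x = 0"
  by (cases x) (auto simp: epowr_def)

lemma epowr_eq_top_iff: "epowr x a = top \<longleftrightarrow> x = top"
  by (cases x) (auto simp: epowr_def)

lemma borel_measurable_epowr [measurable (raw)]:
  assumes [measurable]: "f \<in> borel_measurable M"
  shows "(\<lambda>x. epowr (f x) a) \<in> borel_measurable M"
  unfolding epowr_def by measurable

text \<open>
  Powers are strictly increasing with inverse \<open>epowr _ (1 / a)\<close>, so a strict lower bound of the power is a
  strict lower bound of the sequence.
\<close>

lemma epowr_Liminf_le:
  assumes "0 < a"
  shows "epowr (liminf X) a \<le> liminf (\<lambda>n. epowr (X n) a)"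
  unfolding le_Liminf_iff
proof (intro allI impI)
  fix y assume "y < epowr (liminf X) a"
  then have "epowr y (1 / a) < liminf X"
    using assms by (metis epowr_less_iff epowr_inverse(2) less_irrefl)
  then have "\<forall>\<^sub>F n in sequentially. epowr y (1 / a) < X n"
    using le_Liminf_iff[of "liminf X" sequentially X] by simp
  then show "\<forall>\<^sub>F n in sequentially. y < epowr (X n) a"
    by eventually_elim (metis assms epowr_less_iff epowr_inverse(2) less_irrefl)
qed

text \<open>
  A factor \<open>0\<close> or \<open>\<infinity>\<close> is admitted because a weight may take these values on a null set.
\<close>

lemma ennreal_mult_Liminf_le: "liminf X * c \<le> liminf (\<lambda>n. X n * (c::ennreal))"
proof (cases "c = 0 \<or> c = top")
  case False
  show ?thesis unfolding le_Liminf_iff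
  proof (intro allI impI)
    fix y assume y: "y < liminf X * c"
    have iff: "y < x * c \<longleftrightarrow> y / c < x" for x
      using False by (subst divide_less_ennreal) (auto simp: top.not_eq_extremum)
    show "\<forall>\<^sub>F n in sequentially. y < X n * c"
      using y le_Liminf_iff[of "liminf X" sequentially X] by (simp add: iff)
  qed
next
  case True
  then show ?thesis
  proof
    assume c: "c = top"
    show ?thesis
    proof (cases "liminf X = 0")
      case False
      then have "\<forall>\<^sub>F n in sequentially. 0 < X n"
        using less_LiminfD[of 0 sequentially X] by (simp add: zero_less_iff_neq_zero)
      then have "\<forall>\<^sub>F n in sequentially. top \<le> X n * c"
        by eventually_elim (simp add: c ennreal_mult_top)
      then have "top \<le> liminf (\<lambda>n. X n * c)"
        by (rule Liminf_bounded)
      then show ?thesis by (simp add: top_unique)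
    qed simp
  qed simp
qed

text \<open>
  For \<open>s < 1\<close> this is only a quasi-norm.
\<close>

definition qnorm :: "'a measure \<Rightarrow> real \<Rightarrow> ('a \<Rightarrow> ennreal) \<Rightarrow> ennreal" where
  "qnorm M s g = epowr (\<integral>\<^sup>+x. epowr (g x) s \<partial>M) (1 / s)"

lemma qnorm_mono: "0 < s \<Longrightarrow> AE x in M. f x \<le> g x \<Longrightarrow> qnorm M s f \<le> qnorm M s g"
  unfolding qnorm_def by (intro epowr_mono nn_integral_mono_AE) (auto elim!: eventually_mono intro: epowr_mono)

lemma qnorm_powr: "0 < s \<Longrightarrow> epowr (qnorm M s g) s = (\<integral>\<^sup>+x. epowr (g x) s \<partial>M)"
  unfolding qnorm_def by (simp add: epowr_inverse)

lemma qnorm_epowr: "0 < s \<Longrightarrow> 0 < a \<Longrightarrow> qnorm M s (\<lambda>x. epowr (g x) a) = epowr (qnorm M (s * a) g) a"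
  unfolding qnorm_def by (simp add: epowr_epowr mult.commute)

lemma qnorm_cmult:
  assumes "0 < s" "g \<in> borel_measurable M" 
  shows "qnorm M s (\<lambda>x. c * g x) = c * qnorm M s g"
  unfolding qnorm_def using assms by (simp add: epowr_mult nn_integral_cmult epowr_inverse)

lemma qnorm_eq_0: 
  assumes "0 < s" "g \<in> borel_measurable M" "qnorm M s g = 0"
  shows "AE x in M. g x = 0"
  using assms unfolding qnorm_def by (simp add: epowr_eq_0_iff nn_integral_0_iff_AE)

text \<open>
  Mixed norms are iterated quasi-norms, so one inequality for \<open>qnorm\<close> can be applied in \<open>y\<close> and then in
  \<open>x\<close>.
\<close>

lemma mixed_norm_eq_qnorm:
  assumes "0 < s" "0 < st"
  shows "mixed_norm N Nt s st w F = qnorm N s (\<lambda>x. qnorm Nt st (\<lambda>y. ennreal (norm (F (x, y)))) * w x)"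
  using assms unfolding mixed_norm_def qnorm_def inner_int_def
  by (simp add: epowr_mult epowr_epowr epowr_ennreal)

lemma qnorm_Liminf_le:
  assumes s: "0 < s" and [measurable]: "\<And>n. X n \<in> borel_measurable M"
  shows "qnorm M s (\<lambda>x. liminf (\<lambda>n. X n x)) \<le> liminf (\<lambda>n. qnorm M s (X n))"
proof -
  have "(\<integral>\<^sup>+x. epowr (liminf (\<lambda>n. X n x)) s \<partial>M) \<le> (\<integral>\<^sup>+x. liminf (\<lambda>n. epowr (X n x) s) \<partial>M)"
    by (intro nn_integral_mono epowr_Liminf_le s)
  also have "\<dots> \<le> liminf (\<lambda>n. \<integral>\<^sup>+x. epowr (X n x) s \<partial>M)"
    by (intro nn_integral_liminf) simp
  finally have "qnorm M s (\<lambda>x. liminf (\<lambda>n. X n x)) \<le> epowr (liminf (\<lambda>n. \<integral>\<^sup>+x. epowr (X n x) s \<partial>M)) (1 / s)"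
    unfolding qnorm_def using s by (intro epowr_mono) auto
  also have "\<dots> \<le> liminf (\<lambda>n. qnorm M s (X n))"
    unfolding qnorm_def using s by (intro epowr_Liminf_le) auto
  finally show ?thesis .
qed

lemma ennreal_Young:
  assumes "0 < a" "0 < b" "a + b = 1"
  shows "epowr x a * epowr y b \<le> ennreal a * x + ennreal b * y"
proof (cases "x = top \<or> y = top \<or> x = 0 \<or> y = 0")
  case True then show ?thesis using assms by (auto simp: ennreal_mult_top)
next
  case False
  then obtain x' y' where xy: "x = ennreal x'" "0 < x'" "y = ennreal y'" "0 < y'"
    by (metis ennreal_cases infinity_ennreal_def ennreal_0 order_le_less)
  have "x' powr a * y' powr b \<le> a * x' + b * y'"
    using Youngs_inequality_0[of a b x' y'] assms xy by simp
  then show ?thesis using xy assms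
    by (simp add: epowr_ennreal ennreal_leI flip: ennreal_mult ennreal_plus)
qed

text \<open>
  Normalise both integrals to \<open>1\<close> and integrate the weighted arithmetic-geometric mean inequality; the
  cases in which this is impossible (an integral \<open>0\<close> or \<open>\<infinity>\<close>) are trivial.
\<close>

lemma nn_integral_Hoelder:
  assumes ab: "0 < a" "0 < b" "a + b = 1" and [measurable]: "X \<in> borel_measurable M" "Y \<in> borel_measurable M"
  shows "(\<integral>\<^sup>+x. epowr (X x) a * epowr (Y x) b \<partial>M) \<le> epowr (\<integral>\<^sup>+x. X x \<partial>M) a * epowr (\<integral>\<^sup>+x. Y x \<partial>M) b"
proof -
  let ?I = "\<integral>\<^sup>+x. X x \<partial>M" and ?J = "\<integral>\<^sup>+x. Y x \<partial>M"
  consider "?I = 0" | "?J = 0" | "?I \<noteq> 0" "?J \<noteq> 0" "?I = top \<or> ?J = top" 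
    | "?I \<noteq> 0" "?J \<noteq> 0" "?I \<noteq> top" "?J \<noteq> top" by blast
  then show ?thesis
  proof cases
    case 1
    then have "AE x in M. X x = 0" by (simp add: nn_integral_0_iff_AE)
    then have "(\<integral>\<^sup>+x. epowr (X x) a * epowr (Y x) b \<partial>M) = (\<integral>\<^sup>+x. 0 \<partial>M)"
      by (intro nn_integral_cong_AE) (auto elim!: eventually_mono)
    then show ?thesis by simp
  next
    case 2
    then have "AE x in M. Y x = 0" by (simp add: nn_integral_0_iff_AE)
    then have "(\<integral>\<^sup>+x. epowr (X x) a * epowr (Y x) b \<partial>M) = (\<integral>\<^sup>+x. 0 \<partial>M)"
      by (intro nn_integral_cong_AE) (auto elim!: eventually_mono)
    then show ?thesis by simp
  next
    case 3
    then have "epowr ?I a * epowr ?J b = top"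
      by (auto simp: ennreal_mult_eq_top_iff epowr_eq_0_iff epowr_eq_top_iff)
    then show ?thesis by simp
  next
    case 4
    then obtain i j where i: "?I = ennreal i" "0 < i" and j: "?J = ennreal j" "0 < j"
      by (metis ennreal_cases infinity_ennreal_def ennreal_eq_0_iff not_less order_le_less)
    have "(\<integral>\<^sup>+x. epowr (X x) a * epowr (Y x) b \<partial>M) 
      \<le> (\<integral>\<^sup>+x. epowr ?I a * epowr ?J b * (ennreal (a / i) * X x + ennreal (b / j) * Y x) \<partial>M)"
    proof (intro nn_integral_mono)
      fix x
      have "X x = ?I * (ennreal (1 / i) * X x)" "Y x = ?J * (ennreal (1 / j) * Y x)"
        using i j by (simp_all add: mult.assoc[symmetric] flip: ennreal_mult)
      then have "epowr (X x) a * epowr (Y x) b = 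
        epowr ?I a * epowr ?J b * (epowr (ennreal (1 / i) * X x) a * epowr (ennreal (1 / j) * Y x) b)"
        by (metis (no_types, lifting) epowr_mult mult.assoc mult.left_commute)
      also have "\<dots> \<le> epowr ?I a * epowr ?J b * (ennreal a * (ennreal (1 / i) * X x) + ennreal b * (ennreal (1 / j) * Y x))"
        by (intro mult_left_mono ennreal_Young ab) simp
      also have "\<dots> = epowr ?I a * epowr ?J b * (ennreal (a / i) * X x + ennreal (b / j) * Y x)"
        using ab i j by (simp add: mult.assoc[symmetric] flip: ennreal_mult)
      finally show "epowr (X x) a * epowr (Y x) b \<le> \<dots>" .
    qed
    also have "\<dots> = epowr ?I a * epowr ?J b * (ennreal (a / i) * ?I + ennreal (b / j) * ?J)"
      by (simp add: nn_integral_cmult nn_integral_add)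
    also have "ennreal (a / i) * ?I + ennreal (b / j) * ?J = 1"
      unfolding i(1) j(1) using ab i(2) j(2) 
      by (simp flip: ennreal_mult ennreal_plus)
    finally show ?thesis by simp
  qed
qed

lemma qnorm_Hoelder:
  assumes th: "0 < \<theta>" "\<theta> < 1" and PQ: "0 < P" "0 < Q" and R: "1 / R = (1 - \<theta>) / P + \<theta> / Q"
    and [measurable]: "X \<in> borel_measurable M" "Y \<in> borel_measurable M"
  shows "qnorm M R (\<lambda>x. epowr (X x) (1 - \<theta>) * epowr (Y x) \<theta>) \<le> epowr (qnorm M P X) (1 - \<theta>) * epowr (qnorm M Q Y) \<theta>"
proof -
  have pos: "0 < (1 - \<theta>) / P" "0 < \<theta> / Q" using th PQ by auto
  have R0: "0 < R" using R pos by (metis add_pos_pos zero_less_divide_1_iff)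
  define a where "a = (1 - \<theta>) * R / P"
  define b where "b = \<theta> * R / Q"
  have ab: "0 < a" "0 < b" "a + b = 1"
  proof -
    show "0 < a" "0 < b" using th PQ R0 by (simp_all add: a_def b_def)
    have "a + b = R * (1 / R)" unfolding R a_def b_def by (simp add: distrib_left mult.commute)
    then show "a + b = 1" using R0 by simp
  qed
  have "(\<integral>\<^sup>+x. epowr (epowr (X x) (1 - \<theta>) * epowr (Y x) \<theta>) R \<partial>M)
     = (\<integral>\<^sup>+x. epowr (epowr (X x) P) a * epowr (epowr (Y x) Q) b \<partial>M)"
    using PQ by (simp add: epowr_mult epowr_epowr a_def b_def)
  also have "\<dots> \<le> epowr (\<integral>\<^sup>+x. epowr (X x) P \<partial>M) a * epowr (\<integral>\<^sup>+x. epowr (Y x) Q \<partial>M) b"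
    by (intro nn_integral_Hoelder ab) auto
  finally have "qnorm M R (\<lambda>x. epowr (X x) (1 - \<theta>) * epowr (Y x) \<theta>) \<le> 
     epowr (epowr (\<integral>\<^sup>+x. epowr (X x) P \<partial>M) a * epowr (\<integral>\<^sup>+x. epowr (Y x) Q \<partial>M) b) (1 / R)"
    unfolding qnorm_def using R0 by (intro epowr_mono) auto
  also have "\<dots> = epowr (qnorm M P X) (1 - \<theta>) * epowr (qnorm M Q Y) \<theta>"
    using R0 unfolding qnorm_def by (simp add: epowr_mult epowr_epowr a_def b_def)
  finally show ?thesis .
qed

text \<open>
  The endpoint \<open>0\<close>, where convexity degenerates to \<open>c\<^sup>\<tau> \<le> c\<close> for \<open>0 < c < 1\<close>, and the value \<open>\<infinity>\<close> are
  treated apart from convexity on the open half-line.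
\<close>

lemma powr_convex_ennreal:
  assumes "1 \<le> (\<tau>::real)" "0 < a" "0 < b" "a + b = 1"
  shows "epowr (ennreal a * x + ennreal b * y) \<tau> \<le> ennreal a * epowr x \<tau> + ennreal b * epowr y \<tau>"
proof -
  have shrink: "epowr (ennreal c * z) \<tau> \<le> ennreal c * epowr z \<tau>" if "0 < c" "c < 1" for c z
  proof -
    have "c powr \<tau> \<le> c powr 1" using that assms by (intro powr_mono') auto
    then have "epowr (ennreal c) \<tau> \<le> ennreal c" using that by (simp add: epowr_ennreal ennreal_leI)
    then show ?thesis unfolding epowr_mult by (intro mult_right_mono) auto
  qed
  show ?thesis
  proof (cases "x = top \<or> y = top \<or> x = 0 \<or> y = 0")
    case True then show ?thesis using assms shrink[of a x] shrink[of b y] by (auto simp: ennreal_mult_top)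
  next
    case False
    then obtain x' y' where xy: "x = ennreal x'" "0 < x'" "y = ennreal y'" "0 < y'"
      by (metis ennreal_cases infinity_ennreal_def ennreal_0 order_le_less)
    have "(a * x' + b * y') powr \<tau> \<le> a * x' powr \<tau> + b * y' powr \<tau>"
    proof -
      have "1 - b = a" "b \<le> 1" using assms by simp_all
      then show ?thesis
        using convex_onD[OF powr_convex[OF assms(1)], of b x' y'] assms(2,3) xy \<open>b \<le> 1\<close>
        unfolding \<open>1 - b = a\<close> by simp
    qed
    then show ?thesis using xy assms
      by (simp add: epowr_ennreal ennreal_leI flip: ennreal_mult ennreal_plus)
  qed
qed

text \<open>
  Minkowski: \<open>X + Y\<close> is \<open>\<parallel>X\<parallel> + \<parallel>Y\<parallel>\<close> times a convex combination of \<open>X / \<parallel>X\<parallel>\<close> and \<open>Y / \<parallel>Y\<parallel>\<close>, and the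
  \<open>\<tau>\<close>-th power is convex.
\<close>

lemma qnorm_triangle:
  assumes \<tau>: "1 \<le> \<tau>" and [measurable]: "X \<in> borel_measurable M" "Y \<in> borel_measurable M"
  shows "qnorm M \<tau> (\<lambda>x. X x + Y x) \<le> qnorm M \<tau> X + qnorm M \<tau> Y"
proof -
  have \<tau>0: "0 < \<tau>" using \<tau> by simp
  let ?I = "qnorm M \<tau> X" and ?J = "qnorm M \<tau> Y"
  consider "?I = 0" | "?J = 0" | "?I \<noteq> 0" "?J \<noteq> 0" "?I = top \<or> ?J = top" 
    | "?I \<noteq> 0" "?J \<noteq> 0" "?I \<noteq> top" "?J \<noteq> top" by blast
  then show ?thesis
  proof cases
    case 1
    then have "AE x in M. X x + Y x \<le> Y x" 
      using qnorm_eq_0[OF \<tau>0 _ 1] by (auto elim!: eventually_mono)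
    from qnorm_mono[OF \<tau>0 this] 1 show ?thesis by simp
  next
    case 2
    then have "AE x in M. X x + Y x \<le> X x" 
      using qnorm_eq_0[OF \<tau>0 _ 2] by (auto elim!: eventually_mono)
    from qnorm_mono[OF \<tau>0 this] 2 show ?thesis by simp
  next
    case 3
    then show ?thesis by auto
  next
    case 4
    then obtain i j where i: "?I = ennreal i" "0 < i" and j: "?J = ennreal j" "0 < j"
      by (metis ennreal_cases infinity_ennreal_def ennreal_eq_0_iff not_less order_le_less)
    define a where "a = i / (i + j)"
    define b where "b = j / (i + j)"
    have ab: "0 < a" "0 < b" "a + b = 1"
      using i(2) j(2) by (simp_all add: a_def b_def add_divide_distrib[symmetric])
    have "(\<integral>\<^sup>+x. epowr (X x + Y x) \<tau> \<partial>M) \<le> (\<integral>\<^sup>+x. epowr (ennreal (i + j)) \<tau> * 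
       (ennreal (a / i powr \<tau>) * epowr (X x) \<tau> + ennreal (b / j powr \<tau>) * epowr (Y x) \<tau>) \<partial>M)"
    proof (intro nn_integral_mono)
      fix x
      have "X x + Y x = ennreal (i + j) * (ennreal a * (ennreal (1 / i) * X x) + ennreal b * (ennreal (1 / j) * Y x))"
        using i(2) j(2) ab by (simp add: distrib_left mult.assoc[symmetric] a_def b_def del: ennreal_plus flip: ennreal_mult)
      then have "epowr (X x + Y x) \<tau> = epowr (ennreal (i + j)) \<tau> * epowr (ennreal a * (ennreal (1 / i) * X x) + ennreal b * (ennreal (1 / j) * Y x)) \<tau>"
        by (simp only: epowr_mult)
      also have "\<dots> \<le> epowr (ennreal (i + j)) \<tau> * (ennreal a * epowr (ennreal (1 / i) * X x) \<tau> + ennreal b * epowr (ennreal (1 / j) * Y x) \<tau>)"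
        by (intro mult_left_mono powr_convex_ennreal ab \<tau>) simp
      also have "ennreal a * epowr (ennreal (1 / i) * X x) \<tau> + ennreal b * epowr (ennreal (1 / j) * Y x) \<tau>
        = ennreal (a / i powr \<tau>) * epowr (X x) \<tau> + ennreal (b / j powr \<tau>) * epowr (Y x) \<tau>"
        using i(2) j(2) ab 
        by (simp add: epowr_mult epowr_ennreal powr_divide mult.assoc[symmetric] flip: ennreal_mult)
      finally show "epowr (X x + Y x) \<tau> \<le> epowr (ennreal (i + j)) \<tau> * 
       (ennreal (a / i powr \<tau>) * epowr (X x) \<tau> + ennreal (b / j powr \<tau>) * epowr (Y x) \<tau>)" .
    qed
    also have "\<dots> = epowr (ennreal (i + j)) \<tau> * 
        (ennreal (a / i powr \<tau>) * epowr ?I \<tau> + ennreal (b / j powr \<tau>) * epowr ?J \<tau>)"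
      by (simp add: nn_integral_cmult nn_integral_add qnorm_powr \<tau>0)
    also have "ennreal (a / i powr \<tau>) * epowr ?I \<tau> + ennreal (b / j powr \<tau>) * epowr ?J \<tau> = 1"
      unfolding i(1) j(1) using ab i(2) j(2) 
      by (simp add: epowr_ennreal flip: ennreal_mult ennreal_plus)
    finally have "epowr (qnorm M \<tau> (\<lambda>x. X x + Y x)) \<tau> \<le> epowr (?I + ?J) \<tau>"
      using \<tau>0 i j by (simp add: qnorm_powr flip: ennreal_plus)
    then show ?thesis using \<tau>0 by (simp add: epowr_le_iff)
  qed
qed

lemma qnorm_triangle_sum:
  assumes "1 \<le> \<tau>" "finite K" and "\<And>k. k \<in> K \<Longrightarrow> g k \<in> borel_measurable M"
  shows "qnorm M \<tau> (\<lambda>x. \<Sum>k\<in>K. g k x) \<le> (\<Sum>k\<in>K. qnorm M \<tau> (g k))"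
  using assms(2,3)
proof (induction K rule: finite_induct)
  case empty
  then show ?case by (simp add: qnorm_def)
next
  case (insert k K)
  then have "qnorm M \<tau> (\<lambda>x. g k x + (\<Sum>k\<in>K. g k x)) \<le> qnorm M \<tau> (g k) + qnorm M \<tau> (\<lambda>x. \<Sum>k\<in>K. g k x)"
    using assms(1) by (intro qnorm_triangle borel_measurable_sum) auto
  also have "\<dots> \<le> qnorm M \<tau> (g k) + (\<Sum>k\<in>K. qnorm M \<tau> (g k))"
    using insert by (intro add_left_mono insert.IH) auto
  finally show ?case using insert by simp
qed

text \<open>
  The counterpart of \<open>qnorm\<close> for the uniform distribution on \<open>K\<close>; it is \<open>0\<close> for empty and for infinite \<open>K\<close>.
\<close>

definition power_mean :: "'k set \<Rightarrow> real \<Rightarrow> ('k \<Rightarrow> ennreal) \<Rightarrow> ennreal" where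
  "power_mean K s a = epowr (ennreal (1 / card K) * (\<Sum>k\<in>K. epowr (a k) s)) (1 / s)"

lemma power_mean_mono: "0 < s \<Longrightarrow> (\<And>k. k \<in> K \<Longrightarrow> a k \<le> b k) \<Longrightarrow> power_mean K s a \<le> power_mean K s b"
  unfolding power_mean_def by (intro epowr_mono mult_left_mono sum_mono) auto

lemma power_mean_le:
  assumes "0 < s" "\<And>k. k \<in> K \<Longrightarrow> a k \<le> c" 
  shows "power_mean K s a \<le> c"
proof (cases "finite K \<and> K \<noteq> {}")
  case True
  then have n: "0 < card K" by (simp add: card_gt_0_iff)
  have "power_mean K s a \<le> power_mean K s (\<lambda>_. c)" by (intro power_mean_mono assms)
  also have "\<dots> = epowr (ennreal (1 / card K) * ennreal (card K) * epowr c s) (1 / s)"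
    unfolding power_mean_def by (simp add: mult.assoc ennreal_of_nat_eq_real_of_nat)
  also have "ennreal (1 / card K) * ennreal (card K) = 1"
    using n by (simp flip: ennreal_mult)
  finally show ?thesis using assms by (simp add: epowr_inverse)
next
  case False
  then show ?thesis by (auto simp: power_mean_def)
qed

lemma power_mean_mult: 
  assumes "0 < s"
  shows "power_mean K s (\<lambda>k. a k * c) = power_mean K s a * c"
proof -
  have "ennreal (1 / card K) * (\<Sum>k\<in>K. epowr (a k * c) s) = ennreal (1 / card K) * (\<Sum>k\<in>K. epowr (a k) s) * epowr c s"
    by (simp add: epowr_mult sum_distrib_right mult.assoc)
  then show ?thesis using assms unfolding power_mean_def by (simp add: epowr_mult epowr_inverse)
qed

lemma borel_measurable_power_mean [measurable (raw)]:
  assumes "\<And>k. k \<in> K \<Longrightarrow> g k \<in> borel_measurable M"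
  shows "(\<lambda>x. power_mean K s (\<lambda>k. g k x)) \<in> borel_measurable M"
  unfolding power_mean_def using assms by (intro borel_measurable_epowr borel_measurable_times borel_measurable_sum) auto

text \<open>
  Since \<open>P / s \<ge> 1\<close>, this is Minkowski for the \<open>s\<close>-th powers. Keeping \<open>s\<close> below the exponent of the norm
  is what makes exponents \<open>P < 1\<close> admissible.
\<close>

lemma qnorm_power_mean_le:
  assumes s: "0 < s" "s \<le> P" and g: "\<And>k. k \<in> K \<Longrightarrow> g k \<in> borel_measurable M"
  shows "qnorm M P (\<lambda>x. power_mean K s (\<lambda>k. g k x)) \<le> power_mean K s (\<lambda>k. qnorm M P (g k))"
proof (cases "finite K")
  case True
  have P: "0 < P" using s by simp
  let ?c = "ennreal (1 / card K)"
  have 1: "1 \<le> P / s" using s by simp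
  have m: "(\<lambda>x. epowr (g k x) s) \<in> borel_measurable M" if "k \<in> K" for k
    using g that by auto
  have "qnorm M P (\<lambda>x. power_mean K s (\<lambda>k. g k x)) = epowr (qnorm M (P / s) (\<lambda>x. ?c * (\<Sum>k\<in>K. epowr (g k x) s))) (1 / s)"
    unfolding power_mean_def using s P by (subst qnorm_epowr) auto
  also have "qnorm M (P / s) (\<lambda>x. ?c * (\<Sum>k\<in>K. epowr (g k x) s)) = ?c * qnorm M (P / s) (\<lambda>x. \<Sum>k\<in>K. epowr (g k x) s)"
    using m s P by (intro qnorm_cmult) auto
  also have "epowr \<dots> (1 / s) \<le> epowr (?c * (\<Sum>k\<in>K. qnorm M (P / s) (\<lambda>x. epowr (g k x) s))) (1 / s)"
    using s m True 1 by (intro epowr_mono mult_left_mono qnorm_triangle_sum) auto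
  also have "\<dots> = power_mean K s (\<lambda>k. qnorm M P (g k))"
    unfolding power_mean_def using s P by (simp add: qnorm_epowr)
  finally show ?thesis .
qed (simp add: power_mean_def qnorm_def)

text \<open>
  A pointwise bound by a lower limit of products of power means passes to norms: Fatou removes the
  limit, Hoelder splits the product, and Minkowski moves the norms inside the power means. Only finite
  sums of measurable functions are integrated, which is legitimate on any measure space, and monotonicity
  of the lower integral covers a nonmeasurable \<open>f\<close>.
\<close>

lemma qnorm_interpolation_step:
  assumes th: "0 < \<theta>" "\<theta> < 1" and PQ: "0 < P" "0 < Q" and R: "1 / R = (1 - \<theta>) / P + \<theta> / Q"
    and s: "0 < s0" "s0 \<le> P" "0 < s1" "s1 \<le> Q"
    and g: "\<And>n k. k \<in> K0 n \<Longrightarrow> g n k \<in> borel_measurable M"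
    and h: "\<And>n k. k \<in> K1 n \<Longrightarrow> h n k \<in> borel_measurable M"
    and f: "\<And>x. x \<in> space M \<Longrightarrow> f x \<le> liminf (\<lambda>n. epowr (power_mean (K0 n) s0 (\<lambda>k. g n k x)) (1 - \<theta>)
            * epowr (power_mean (K1 n) s1 (\<lambda>k. h n k x)) \<theta>)"
  shows "qnorm M R f \<le> liminf (\<lambda>n. epowr (power_mean (K0 n) s0 (\<lambda>k. qnorm M P (g n k))) (1 - \<theta>)
            * epowr (power_mean (K1 n) s1 (\<lambda>k. qnorm M Q (h n k))) \<theta>)"
proof -
  have pos: "0 < (1 - \<theta>) / P" "0 < \<theta> / Q" using th PQ by auto
  have R0: "0 < R" using R pos by (metis add_pos_pos zero_less_divide_1_iff)
  let ?X = "\<lambda>n x. power_mean (K0 n) s0 (\<lambda>k. g n k x)" and ?Y = "\<lambda>n x. power_mean (K1 n) s1 (\<lambda>k. h n k x)"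
  have X [measurable]: "?X n \<in> borel_measurable M" for n using g by (rule borel_measurable_power_mean)
  have Y [measurable]: "?Y n \<in> borel_measurable M" for n using h by (rule borel_measurable_power_mean)
  have "qnorm M R f \<le> qnorm M R (\<lambda>x. liminf (\<lambda>n. epowr (?X n x) (1 - \<theta>) * epowr (?Y n x) \<theta>))"
    using f by (intro qnorm_mono R0) auto
  also have "\<dots> \<le> liminf (\<lambda>n. qnorm M R (\<lambda>x. epowr (?X n x) (1 - \<theta>) * epowr (?Y n x) \<theta>))"
    by (intro qnorm_Liminf_le R0) simp
  also have "\<dots> \<le> liminf (\<lambda>n. epowr (power_mean (K0 n) s0 (\<lambda>k. qnorm M P (g n k))) (1 - \<theta>)
            * epowr (power_mean (K1 n) s1 (\<lambda>k. qnorm M Q (h n k))) \<theta>)"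
  proof (intro Liminf_mono always_eventually allI)
    fix n
    have "qnorm M R (\<lambda>x. epowr (?X n x) (1 - \<theta>) * epowr (?Y n x) \<theta>) \<le> epowr (qnorm M P (?X n)) (1 - \<theta>) * epowr (qnorm M Q (?Y n)) \<theta>"
      by (intro qnorm_Hoelder th PQ R X Y)
    also have "\<dots> \<le> epowr (power_mean (K0 n) s0 (\<lambda>k. qnorm M P (g n k))) (1 - \<theta>)
            * epowr (power_mean (K1 n) s1 (\<lambda>k. qnorm M Q (h n k))) \<theta>"
      using th s g h by (intro mult_mono epowr_mono qnorm_power_mean_le) auto
    finally show "qnorm M R (\<lambda>x. epowr (?X n x) (1 - \<theta>) * epowr (?Y n x) \<theta>) \<le> \<dots>" .
  qed
  finally show ?thesis .
qed

section \<open>Logarithmic means on the unit circle\<close>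

text \<open>
  On the unit circle \<open>z * cnj z = 1\<close>, so every mixed monomial \<open>z\<^sup>i * cnj z\<^sup>j\<close> collapses to a pure power of \<open>z\<close>
  or of \<open>cnj z\<close>, and real parts do not distinguish these. This makes the real parts of polynomials closed
  under products, as the Stone-Weierstrass theorem demands.
\<close>

lemma Re_poly_mult_cnj_poly:
  fixes p q :: "complex poly"
  shows "\<exists>s. \<forall>z. norm z = 1 \<longrightarrow> Re (poly p z * cnj (poly q z)) = Re (poly s z)"
proof (induction p arbitrary: q)
  case 0
  show ?case by (intro exI[of _ 0]) simp
next
  case (pCons a p)
  obtain b q' where q: "q = pCons b q'" by (cases q)
  obtain s where s: "\<And>z. norm z = 1 \<Longrightarrow> Re (poly p z * cnj (poly q' z)) = Re (poly s z)"
    using pCons.IH by blast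
  show ?case
  proof (intro exI allI impI)
    fix z :: complex assume z: "norm z = 1"
    have zz: "z * cnj z = 1" using z by (simp add: complex_norm_square[symmetric])
    have "poly (pCons a p) z * cnj (poly q z)
       = a * cnj (poly q z) + z * poly p z * cnj b + (z * cnj z) * (poly p z * cnj (poly q' z))"
      by (simp add: q algebra_simps)
    then have "Re (poly (pCons a p) z * cnj (poly q z)) 
       = Re (a * cnj (poly q z)) + Re (z * poly p z * cnj b) + Re (poly s z)"
      using s[OF z] by (simp add: zz)
    also have "Re (a * cnj (poly q z)) = Re (cnj a * poly q z)"
      by simp
    finally show "Re (poly (pCons a p) z * cnj (poly q z)) 
        = Re (poly (smult (cnj a) q + pCons 0 (smult (cnj b) p) + s) z)"
      by (simp add: mult_ac)
  qed
qed

text \<open>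
  Every continuous function on the circle is thus nearly the boundary value of a harmonic polynomial,
  which replaces the solution of the Dirichlet problem on the disc.
\<close>

lemma continuous_circle_approx_Re_poly:
  fixes f :: "complex \<Rightarrow> real"
  assumes f: "continuous_on (sphere 0 1) f" and "0 < e"
  obtains p :: "complex poly" where "\<And>z. norm z = 1 \<Longrightarrow> \<bar>f z - Re (poly p z)\<bar> < e"
proof -
  define P where "P = (\<lambda>g :: complex \<Rightarrow> real. \<exists>p :: complex poly. \<forall>z. norm z = 1 \<longrightarrow> g z = Re (poly p z))"
  have "\<exists>g. P g \<and> (\<forall>x\<in>sphere 0 1. \<bar>f x - g x\<bar> < e)"
  proof (rule Stone_Weierstrass_HOL)
    show "compact (sphere (0::complex) 1)" by simp
    show "P (\<lambda>x. c)" for c unfolding P_def by (intro exI[of _ "[:of_real c:]"]) simp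
    show "continuous_on (sphere 0 1) g" if "P g" for g
    proof -
      from that obtain p :: "complex poly" where p: "\<And>z. norm z = 1 \<Longrightarrow> g z = Re (poly p z)" unfolding P_def by blast
      have "continuous_on (sphere 0 1) (\<lambda>z. Re (poly p z))" by (intro continuous_intros)
      then show ?thesis by (rule continuous_on_eq) (simp add: p)
    qed
    fix g h :: "complex \<Rightarrow> real" assume "P g \<and> P h"
    then obtain p q :: "complex poly" where p: "\<And>z. norm z = 1 \<Longrightarrow> g z = Re (poly p z)" 
       and q: "\<And>z. norm z = 1 \<Longrightarrow> h z = Re (poly q z)" unfolding P_def by metis
    show "P (\<lambda>x. g x + h x)" unfolding P_def using p q by (intro exI[of _ "p + q"]) simp
    obtain s where s: "\<And>z. norm z = 1 \<Longrightarrow> Re (poly p z * cnj (poly q z)) = Re (poly s z)"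
      using Re_poly_mult_cnj_poly by blast
    show "P (\<lambda>x. g x * h x)" unfolding P_def
    proof (intro exI allI impI)
      fix z :: complex assume z: "norm z = 1"
      have "Re (poly p z) * Re (poly q z) = (Re (poly p z * poly q z) + Re (poly p z * cnj (poly q z))) / 2"
        by simp
      also have "\<dots> = Re (poly (smult (1/2) (p * q + s)) z)"
        unfolding s[OF z] by simp
      finally show "g z * h z = Re (poly (smult (1/2) (p * q + s)) z)"
        using p q z by simp
    qed
  next
    fix x y :: complex assume "x \<in> sphere 0 1 \<and> y \<in> sphere 0 1 \<and> x \<noteq> y"
    moreover have "P Re" unfolding P_def by (intro exI[of _ "[:0, 1:]"]) simp
    moreover have "P Im" unfolding P_def by (intro exI[of _ "[:0, -\<i>:]"]) simp
    ultimately show "\<exists>g. P g \<and> g x \<noteq> g y" by (metis complex_eqI)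
  qed (use assms in auto)
  then show ?thesis using that unfolding P_def by (metis dist_0_norm mem_sphere)
qed

text \<open>
  The mean value property in discrete form: averaging over more roots of unity than the degree is exact.
\<close>

lemma sum_poly_roots_of_unity:
  fixes p :: "complex poly" and N :: nat
  assumes N: "degree p < N"
  shows "(\<Sum>k<N. poly p (cis (2 * pi * real k / real N))) = of_nat N * poly p 0"
proof -
  have "(\<Sum>k<N. poly p (cis (2 * pi * real k / real N))) = (\<Sum>i\<le>degree p. coeff p i * (\<Sum>k<N. cis (2 * pi * k / N) ^ i))"
    unfolding poly_altdef by (subst sum.swap) (simp add: sum_distrib_left)
  also have "\<dots> = (\<Sum>i\<le>degree p. if i = 0 then of_nat N * coeff p 0 else 0)"
  proof (intro sum.cong refl)
    fix i assume i: "i \<in> {..degree p}"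
    show "coeff p i * (\<Sum>k<N. cis (2 * pi * k / N) ^ i) = (if i = 0 then of_nat N * coeff p 0 else 0)"
    proof (cases "i = 0")
      case False
      define w where "w = cis (2 * pi * i / N)"
      have eq: "cis (2 * pi * k / N) ^ i = w ^ k" for k
        unfolding w_def Complex.DeMoivre by (rule arg_cong[where f = cis]) simp
      have "w ^ N = 1" unfolding w_def using N
        by (simp add: Complex.DeMoivre)
      moreover have "w \<noteq> 1"
      proof
        assume "w = 1"
        then have "exp (2 * pi * i / N * \<i>) = 1" unfolding w_def cis_conv_exp by (simp add: mult_ac)
        then obtain n :: int where "2 * pi * i / N = 2 * n * pi" 
          unfolding exp_eq_1 by auto
        then have "real i = n * N" using N by (simp add: field_simps)
        then have "int i = n * int N" by (metis of_int_eq_iff of_int_mult of_int_of_nat_eq)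
        then have "int N dvd int i" by simp
        then show False using N i False by (auto dest!: dvd_imp_le)
      qed
      ultimately have "(\<Sum>k<N. w ^ k) = 0" by (simp add: sum_gp_strict)
      then show ?thesis using False by (simp add: eq)
    qed simp
  qed
  also have "\<dots> = of_nat N * poly p 0" by (simp add: poly_0_coeff_0)
  finally show ?thesis .
qed

text \<open>
  Subharmonicity of \<open>log |f|\<close> at the centre, with the circular mean replaced by averages over roots of
  unity. A polynomial \<open>p\<close> whose real part approximates \<open>ln (|f| + \<delta>)\<close> on the circle makes \<open>f * exp (- p)\<close> nearly
  bounded by \<open>1\<close> there, so the maximum principle bounds \<open>|f 0|\<close> by \<open>exp (Re (p 0))\<close>, and \<open>Re (p 0)\<close> is an average
  of boundary values. The shift by \<open>\<delta>\<close> keeps the logarithm continuous at zeros of \<open>f\<close>.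
\<close>

lemma disc_log_mean:
  assumes cont: "continuous_on (cball 0 1) f" and hol: "f holomorphic_on ball 0 1"
    and \<delta>: "0 < \<delta>" and \<epsilon>: "0 < \<epsilon>"
  shows "\<forall>\<^sub>F N in sequentially. 
    norm (f 0) \<le> exp (\<epsilon> + (\<Sum>k<N. ln (norm (f (cis (2 * pi * k / N))) + \<delta>)) / N)"
proof -
  have sub: "sphere 0 1 \<subseteq> cball (0::complex) 1" by auto
  have pos: "0 < norm (f z) + \<delta>" for z using \<delta> by (simp add: add_nonneg_pos)
  have "continuous_on (sphere 0 1) (\<lambda>z. ln (norm (f z) + \<delta>))"
    using pos by (intro continuous_intros continuous_on_subset[OF cont sub]) (metis less_irrefl)
  then obtain p where p: "\<And>z. norm z = 1 \<Longrightarrow> \<bar>ln (norm (f z) + \<delta>) - Re (poly p z)\<bar> < \<epsilon> / 2"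
    using continuous_circle_approx_Re_poly[of _ "\<epsilon> / 2"] \<epsilon> by (metis half_gt_zero)
  have "norm (f 0 * exp (- poly p 0)) \<le> exp (\<epsilon> / 2)"
  proof (rule maximum_modulus_frontier[where S = "cball 0 1" and f = "\<lambda>z. f z * exp (- poly p z)"])
    show "(\<lambda>z. f z * exp (- poly p z)) holomorphic_on interior (cball 0 1)"
      using hol by (auto intro!: holomorphic_intros)
    show "continuous_on (closure (cball 0 1)) (\<lambda>z. f z * exp (- poly p z))"
      using cont by (auto intro!: continuous_intros)
    fix z :: complex assume "z \<in> frontier (cball 0 1)"
    then have z: "norm z = 1" by (simp add: frontier_cball)
    have "norm (f z) \<le> exp (ln (norm (f z) + \<delta>))" using pos[of z] \<delta> by simp
    also have "\<dots> \<le> exp (Re (poly p z) + \<epsilon> / 2)"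
      unfolding exp_le_cancel_iff using p[OF z] by linarith
    finally have "norm (f z) * exp (- Re (poly p z)) \<le> exp (Re (poly p z) + \<epsilon> / 2) * exp (- Re (poly p z))"
      by (rule mult_right_mono) simp
    then show "norm (f z * exp (- poly p z)) \<le> exp (\<epsilon> / 2)"
      by (simp add: norm_mult norm_exp_eq_Re flip: exp_add)
  qed auto
  then have "norm (f 0) * exp (- Re (poly p 0)) * exp (Re (poly p 0)) \<le> exp (\<epsilon> / 2) * exp (Re (poly p 0))"
    by (intro mult_right_mono) (simp_all add: norm_mult norm_exp_eq_Re)
  then have f0: "norm (f 0) \<le> exp (\<epsilon> / 2 + Re (poly p 0))"
    by (simp add: mult.assoc flip: exp_add)
  show ?thesis
    using eventually_gt_at_top[of "degree p"]
  proof eventually_elim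
    case (elim N)
    have "N * Re (poly p 0) = Re (\<Sum>k<N. poly p (cis (2 * pi * real k / real N)))"
      by (subst sum_poly_roots_of_unity[OF elim]) simp
    also have "\<dots> \<le> (\<Sum>k<N. ln (norm (f (cis (2 * pi * k / N))) + \<delta>) + \<epsilon> / 2)"
      unfolding Re_sum
    proof (rule sum_mono)
      fix k
      have "norm (cis (2 * pi * k / N)) = 1" by simp
      from p[OF this] show "Re (poly p (cis (2 * pi * k / N))) \<le> ln (norm (f (cis (2 * pi * k / N))) + \<delta>) + \<epsilon> / 2"
        by linarith
    qed
    also have "\<dots> = (\<Sum>k<N. ln (norm (f (cis (2 * pi * k / N))) + \<delta>)) + N * (\<epsilon> / 2)"
      by (simp add: sum.distrib)
    finally have "Re (poly p 0) \<le> \<epsilon> / 2 + (\<Sum>k<N. ln (norm (f (cis (2 * pi * k / N))) + \<delta>)) / N"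
      using elim by (simp add: field_simps)
    then show ?case
      using f0 by (smt (verit) exp_le_cancel_iff field_sum_of_halves)
  qed
qed

section \<open>A conformal map from the disc onto the strip\<close>

text \<open>
  The Moebius map \<open>z \<mapsto> (c - cnj c * z) / (1 - z)\<close> with \<open>c = cis (pi * \<theta>)\<close> takes the unit disc to the upper
  half-plane and \<open>0\<close> to \<open>c\<close>; a logarithm divided by \<open>\<i> * pi\<close> takes this half-plane to the strip. The factor
  \<open>- \<i>\<close> turns the upper half-plane into the right one, where the principal logarithm is continuous up to
  the boundary. The two boundary points \<open>1\<close> and \<open>cis (2 * pi * \<theta>)\<close> correspond to the two ends of the strip.
\<close>

definition strip_map :: "real \<Rightarrow> complex \<Rightarrow> complex" where
  "strip_map \<theta> z = 1 / 2 - \<i> / pi * Ln (- \<i> * ((cis (pi * \<theta>) - cis (- (pi * \<theta>)) * z) / (1 - z)))"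

text \<open>
  The sign of the real part comes from the identity
  \<open>Im ((c - cnj c * z) / (1 - z)) = sin (pi * \<theta>) * (1 - |z|\<^sup>2) / |1 - z|\<^sup>2\<close>.
\<close>

lemma strip_map_arg:
  assumes \<theta>: "0 < \<theta>" "\<theta> < 1" and z: "norm z \<le> 1" "z \<noteq> 1" "z \<noteq> cis (2 * pi * \<theta>)"
  defines "u \<equiv> - \<i> * ((cis (pi * \<theta>) - cis (- (pi * \<theta>)) * z) / (1 - z))"
  shows "u \<noteq> 0" "0 \<le> Re u" "u \<notin> \<real>\<^sub>\<le>\<^sub>0"
proof -
  let ?c = "cis (pi * \<theta>)"
  have "?c - cis (- (pi * \<theta>)) * z \<noteq> 0"
  proof
    assume "?c - cis (- (pi * \<theta>)) * z = 0"
    then have "?c * ?c = ?c * cis (- (pi * \<theta>)) * z" by simp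
    then show False using z by (simp add: cis_mult mult_ac)
  qed
  then show u0: "u \<noteq> 0" using z by (simp add: u_def)
  have Re_rot: "Re (- \<i> * q) = Im q" for q by simp
  have "Re u = Im ((?c - cnj ?c * z) / (1 - z))" unfolding u_def Re_rot by (simp add: cis_cnj)
  also have "\<dots> = Im ((?c - cnj ?c * z) * cnj (1 - z)) / (norm (1 - z))\<^sup>2"
    by (subst complex_div_cnj) simp
  also have "(?c - cnj ?c * z) * cnj (1 - z) = (?c + cnj ?c * (z * cnj z)) - (cnj ?c * z + cnj (cnj ?c * z))"
    by (simp add: algebra_simps)
  also have "Im \<dots> = sin (pi * \<theta>) * (1 - (norm z)\<^sup>2)"
    unfolding complex_norm_square[symmetric] by (simp add: algebra_simps del: of_real_power) 
  also have "\<dots> / (norm (1 - z))\<^sup>2 \<ge> 0"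
    using \<theta> z by (intro divide_nonneg_nonneg mult_nonneg_nonneg sin_ge_zero) (auto simp: power_le_one)
  finally show "0 \<le> Re u" .
  then show "u \<notin> \<real>\<^sub>\<le>\<^sub>0" using u0 by (auto simp: complex_nonpos_Reals_iff complex_eq_iff)
qed

lemma Re_strip_map: "Re (strip_map \<theta> z) 
   = 1 / 2 + Im (Ln (- \<i> * ((cis (pi * \<theta>) - cis (- (pi * \<theta>)) * z) / (1 - z)))) / pi"
  by (simp add: strip_map_def)

lemma strip_map_in_strip:
  assumes \<theta>: "0 < \<theta>" "\<theta> < 1" and z: "norm z \<le> 1" "z \<noteq> 1" "z \<noteq> cis (2 * pi * \<theta>)"
  shows "0 \<le> Re (strip_map \<theta> z)" "Re (strip_map \<theta> z) \<le> 1"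
proof -
  define b where "b = Im (Ln (- \<i> * ((cis (pi * \<theta>) - cis (- (pi * \<theta>)) * z) / (1 - z))))"
  have "\<bar>b\<bar> \<le> pi / 2"
    using strip_map_arg[OF assms] Re_Ln_pos_le unfolding b_def by blast
  then have "\<bar>b / pi\<bar> \<le> 1 / 2" by (simp add: field_simps)
  then show "0 \<le> Re (strip_map \<theta> z)" "Re (strip_map \<theta> z) \<le> 1"
    unfolding Re_strip_map b_def by linarith+
qed

lemma strip_map_0: 
  assumes \<theta>: "0 < \<theta>" "\<theta> < 1" 
  shows "strip_map \<theta> 0 = \<theta>"
proof -
  have "- \<i> * cis (pi * \<theta>) = cis (pi * \<theta> - pi / 2)"
    by (simp add: cis_divide[symmetric])
  also have "Ln \<dots> = \<i> * (pi * \<theta> - pi / 2)"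
  proof -
    have "pi * \<theta> \<le> pi" "0 < pi * \<theta>" using \<theta> by auto
    moreover have "Im (\<i> * complex_of_real (pi * \<theta> - pi / 2)) = pi * \<theta> - pi / 2" by simp
    ultimately show ?thesis unfolding cis_conv_exp by (subst Ln_exp) (linarith+, rule refl)
  qed
  finally have "strip_map \<theta> 0 = 1 / 2 - \<i> / pi * (\<i> * (pi * \<theta> - pi / 2))"
    unfolding strip_map_def by simp
  also have "\<dots> = \<theta>" by (simp add: field_simps)
  finally show ?thesis .
qed

lemma strip_map_continuous_on:
  assumes \<theta>: "0 < \<theta>" "\<theta> < 1"
  shows "continuous_on (cball 0 1 - {1, cis (2 * pi * \<theta>)}) (strip_map \<theta>)"
  unfolding strip_map_def using strip_map_arg(3)[OF \<theta>] by (intro continuous_intros) auto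

lemma strip_map_holomorphic_on:
  assumes \<theta>: "0 < \<theta>" "\<theta> < 1"
  shows "strip_map \<theta> holomorphic_on ball 0 1"
proof -
  have "z \<noteq> 1" "z \<noteq> cis (2 * pi * \<theta>)" if "z \<in> ball 0 1" for z using that by auto
  then show ?thesis
    unfolding strip_map_def using strip_map_arg(3)[OF \<theta>] by (intro holomorphic_intros) auto
qed

text \<open>
  At \<open>z = cis (2 * pi * t)\<close> the Moebius map has the real value \<open>sin (pi * (t - \<theta>)) / sin (pi * t)\<close>, whose sign
  decides the side of the strip. The arc of relative length \<open>\<theta>\<close> goes to \<open>Re z = 1\<close>, which is how the weights
  \<open>1 - \<theta>\<close> and \<open>\<theta>\<close> of the interpolation arise as harmonic measures.
\<close>

lemma Re_strip_map_circle:
  assumes \<theta>: "0 < \<theta>" "\<theta> < 1" and t: "0 < t" "t < 1"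
  shows "t < \<theta> \<Longrightarrow> Re (strip_map \<theta> (cis (2 * pi * t))) = 1"
    and "\<theta> < t \<Longrightarrow> Re (strip_map \<theta> (cis (2 * pi * t))) = 0"
proof -
  define r where "r = sin (pi * (t - \<theta>)) / sin (pi * t)"
  have st: "0 < sin (pi * t)" using t by (intro sin_gt_zero) auto
  let ?e = "cis (pi * t)"
  have 1: "cis (2 * pi * t) = ?e * ?e" by (simp add: cis_mult mult.assoc)
  have 2: "1 - cis (2 * pi * t) = ?e * (- 2 * \<i> * sin (pi * t))"
  proof -
    have "1 - cis (2 * pi * t) = ?e * (cis (- (pi * t)) - ?e)"
      by (simp add: cis_mult right_diff_distrib mult.assoc)
    also have "cis (- (pi * t)) - ?e = - 2 * \<i> * sin (pi * t)"
      by (simp add: complex_eq_iff)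
    finally show ?thesis .
  qed
  have 3: "cis (pi * \<theta>) - cis (- (pi * \<theta>)) * cis (2 * pi * t) = ?e * (- 2 * \<i> * sin (pi * (t - \<theta>)))"
  proof -
    have "cis (pi * \<theta>) - cis (- (pi * \<theta>)) * cis (2 * pi * t) = ?e * (cis (- (pi * (t - \<theta>))) - cis (pi * (t - \<theta>)))"
      by (simp add: cis_mult right_diff_distrib algebra_simps)
    also have "cis (- (pi * (t - \<theta>))) - cis (pi * (t - \<theta>)) = - 2 * \<i> * sin (pi * (t - \<theta>))"
      by (simp add: complex_eq_iff)
    finally show ?thesis .
  qed
  have "(cis (pi * \<theta>) - cis (- (pi * \<theta>)) * cis (2 * pi * t)) / (1 - cis (2 * pi * t)) = of_real r"
    unfolding 2 3 r_def using st by simp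
  then have R: "Re (strip_map \<theta> (cis (2 * pi * t))) = 1 / 2 + Im (Ln (- \<i> * of_real r)) / pi"
    unfolding Re_strip_map by simp
  {
    assume "t < \<theta>"
    then have "0 < sin (pi * (\<theta> - t))" using t \<theta> by (intro sin_gt_zero) auto
    then have "sin (pi * (t - \<theta>)) < 0" by (metis minus_diff_eq mult_minus_right neg_0_less_iff_less sin_minus)
    then have "r < 0" unfolding r_def using st by (simp add: divide_neg_pos)
    then have "Ln (- \<i> * of_real r) = ln (- r) + \<i> * pi / 2"
      using Ln_times_of_real[of "- r" "\<i>"] Ln_of_real[of "- r"] by (simp add: mult_ac)
    then show "Re (strip_map \<theta> (cis (2 * pi * t))) = 1" unfolding R by simp
  next
    assume "\<theta> < t"
    then have "0 < sin (pi * (t - \<theta>))" using t \<theta> by (intro sin_gt_zero) auto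
    then have "0 < r" unfolding r_def using st by simp
    then have "Ln (- \<i> * of_real r) = ln r - \<i> * pi / 2"
      using Ln_times_of_real[of r "- \<i>"] Ln_of_real[of r] by (simp add: mult_ac)
    then show "Re (strip_map \<theta> (cis (2 * pi * t))) = 0" unfolding R by simp
  }
qed

section \<open>Power means over sample points on the two lines\<close>

definition strip_bounded :: "(complex \<Rightarrow> complex) \<Rightarrow> bool" where
  "strip_bounded h \<longleftrightarrow> h holomorphic_on UNIV \<and> bounded (h ` {z. 0 \<le> Re z \<and> Re z \<le> 1})"

definition strip_pt :: "real \<Rightarrow> nat \<Rightarrow> nat \<Rightarrow> complex" where
  "strip_pt \<theta> N k = strip_map \<theta> (cis (2 * pi * real k / real N))"

text \<open>
  Indices of the \<open>N\<close>-th roots of unity that \<open>strip_map\<close> sends to \<open>Re z = 0\<close>; the indices \<open>0\<close> and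
  \<open>\<theta> * real N\<close> of the two singular points are left out here and below.
\<close>

definition left_pts :: "real \<Rightarrow> nat \<Rightarrow> nat set" where
  "left_pts \<theta> N = {k. k < N \<and> \<theta> * real N < real k}"

definition right_pts :: "real \<Rightarrow> nat \<Rightarrow> nat set" where
  "right_pts \<theta> N = {k. 0 < k \<and> real k < \<theta> * real N}"

text \<open>
  The composition with \<open>strip_map\<close> is bounded on the disc but need not extend continuously to the two
  boundary points at the ends of the strip. The factor \<open>\<kappa>\<close>, bounded by \<open>1\<close> on the disc, vanishes at these
  points and equals \<open>1 / (1 + d)\<^sup>2\<close> at the centre, so for small \<open>d\<close> it repairs continuity at negligible cost.
\<close>

lemma strip_log_mean:
  assumes \<theta>: "0 < \<theta>" "\<theta> < 1" and h: "strip_bounded h" and \<delta>: "0 < \<delta>" "\<delta> \<le> 1" and \<epsilon>: "0 < \<epsilon>"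
  shows "\<forall>\<^sub>F N in sequentially. norm (h \<theta>) \<le> exp (\<epsilon> + 
     ((\<Sum>k\<in>left_pts \<theta> N. ln (norm (h (strip_pt \<theta> N k)) + \<delta>)) + 
      (\<Sum>k\<in>right_pts \<theta> N. ln (norm (h (strip_pt \<theta> N k)) + \<delta>))) / real N)"
proof -
  define a where "a = cis (2 * pi * \<theta>)"
  define d where "d = \<epsilon> / 4"
  define \<kappa> where "\<kappa> z = (1 - z) / (1 + d - z) * ((1 - cnj a * z) / (1 + d - cnj a * z))" for z :: complex
  define g where "g z = (if z \<in> {1, a} then 0 else h (strip_map \<theta> z) * \<kappa> z)" for z
  have d: "0 < d" using \<epsilon> by (simp add: d_def)
  have na: "norm a = 1" "norm (cnj a) = 1" "cnj a * a = 1" "a * cnj a = 1"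
    by (simp_all add: a_def cis_cnj cis_mult)
  obtain C where C: "\<And>z. 0 \<le> Re z \<Longrightarrow> Re z \<le> 1 \<Longrightarrow> norm (h z) \<le> C" and C0: "0 < C"
    using h unfolding strip_bounded_def bounded_pos by auto
  have hol: "h holomorphic_on UNIV" using h by (simp add: strip_bounded_def)
  have nz: "1 + d - z \<noteq> 0" "norm ((1 - z) / (1 + d - z)) \<le> 1" if "norm z \<le> 1" for z :: complex
  proof -
    have r: "Re z \<le> 1" using that complex_Re_le_cmod[of z] by linarith
    then show nz: "1 + d - z \<noteq> 0" using d by (auto simp: complex_eq_iff)
    have "norm (1 - z) \<le> norm (1 + d - z)"
    proof -
      have "(1 - Re z)\<^sup>2 \<le> (1 + d - Re z)\<^sup>2" using r d by (intro power_mono) auto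
      then show ?thesis by (simp add: cmod_def)
    qed
    then show "norm ((1 - z) / (1 + d - z)) \<le> 1" using nz by (simp add: norm_divide)
  qed
  have cz: "norm (cnj a * z) \<le> 1" if "norm z \<le> 1" for z
    using that na by (simp add: norm_mult)
  have \<kappa>_le: "norm (\<kappa> z) \<le> 1" if "norm z \<le> 1" for z
    unfolding \<kappa>_def norm_mult using nz(2)[OF that] nz(2)[OF cz[OF that]] by (intro mult_le_one) auto
  have \<kappa>_cont: "continuous_on (cball 0 1) \<kappa>"
    unfolding \<kappa>_def using nz(1) cz by (intro continuous_intros) auto
  have \<kappa>_hol: "\<kappa> holomorphic_on ball 0 1"
    unfolding \<kappa>_def using nz(1) cz by (intro holomorphic_intros) auto
  have \<kappa>_zero: "\<kappa> z = 0" if "z \<in> {1, a}" for z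
    using that na by (auto simp: \<kappa>_def)
  have \<kappa>_0: "\<kappa> 0 = 1 / (1 + d)\<^sup>2"
    by (simp add: \<kappa>_def power2_eq_square)
  have g_le: "norm (g z) \<le> C * norm (\<kappa> z)" if "norm z \<le> 1" for z
    using C[OF strip_map_in_strip[OF \<theta> that]] C0 unfolding g_def a_def by (auto simp: norm_mult intro!: mult_right_mono)
  have g_cont: "continuous_on (cball 0 1) g"
    unfolding continuous_on_eq_continuous_within
  proof
    fix x :: complex assume x: "x \<in> cball 0 1"
    show "continuous (at x within cball 0 1) g"
    proof (cases "x \<in> {1, a}")
      case True
      have "(\<kappa> \<longlongrightarrow> 0) (at x within cball 0 1)"
        using \<kappa>_cont x \<kappa>_zero[OF True] unfolding continuous_on_def by metis
      then have null: "((\<lambda>z. C * norm (\<kappa> z)) \<longlongrightarrow> 0) (at x within cball 0 1)"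
        by (intro tendsto_mult_right_zero tendsto_norm_zero)
      have "\<forall>\<^sub>F z in at x within cball 0 1. norm (g z) \<le> C * norm (\<kappa> z)"
        using g_le by (auto simp: eventually_at_filter)
      then have "(g \<longlongrightarrow> 0) (at x within cball 0 1)"
        using null by (rule Lim_null_comparison)
      moreover have "g x = 0" using True by (simp add: g_def)
      ultimately show ?thesis by (simp add: continuous_within)
    next
      case False
      let ?S = "cball 0 1 - {1, a}"
      have "continuous_on ?S (\<lambda>z. h (strip_map \<theta> z) * \<kappa> z)"
        using strip_map_continuous_on[OF \<theta>] unfolding a_def[symmetric]
        by (intro continuous_intros continuous_on_subset[OF \<kappa>_cont] 
             continuous_on_compose2[OF holomorphic_on_imp_continuous_on[OF hol]]) auto
      then have "continuous_on ?S g"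
        by (rule continuous_on_eq) (simp add: g_def)
      then have "continuous (at x within ?S) g"
        using x False by (simp add: continuous_on_eq_continuous_within)
      moreover have "at x within cball 0 1 = at x within ?S"
        using False by (intro at_within_nhd[where S = "- {1, a}"]) auto
      ultimately show ?thesis by simp
    qed
  qed
  have "(\<lambda>z. h (strip_map \<theta> z) * \<kappa> z) holomorphic_on ball 0 1"
    using strip_map_holomorphic_on[OF \<theta>] \<kappa>_hol hol
    by (intro holomorphic_intros holomorphic_on_compose_gen[OF _ hol, unfolded o_def]) auto
  then have g_hol: "g holomorphic_on ball 0 1"
  proof (rule holomorphic_transform)
    fix z :: complex assume "z \<in> ball 0 1"
    then have "z \<noteq> 1" "z \<noteq> a" using na by auto
    then show "h (strip_map \<theta> z) * \<kappa> z = g z" by (simp add: g_def)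
  qed
  have "norm (h \<theta>) = norm (g 0) * (1 + d)\<^sup>2"
  proof -
    have "a \<noteq> 0" using na by auto
    moreover have "norm (1 + complex_of_real d) = 1 + d"
      using norm_of_real[of "1 + d", where 'a = complex] d by simp
    ultimately have "norm (g 0) = norm (h \<theta>) / (1 + d)\<^sup>2"
      by (simp add: g_def \<kappa>_0 strip_map_0[OF \<theta>] norm_mult norm_divide norm_power)
    then show ?thesis using d by simp
  qed
  also have "\<dots> \<le> norm (g 0) * exp (\<epsilon> / 2)"
  proof -
    have "(1 + d)\<^sup>2 \<le> (exp d)\<^sup>2" using d by (intro power_mono exp_ge_add_one_self) auto
    also have "\<dots> = exp (\<epsilon> / 2)" by (simp add: d_def flip: exp_of_nat_mult)
    finally show ?thesis by (intro mult_left_mono) auto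
  qed
  finally have h_le: "norm (h \<theta>) \<le> norm (g 0) * exp (\<epsilon> / 2)" .
  have "\<forall>\<^sub>F N in sequentially. norm (g 0) \<le> exp (\<epsilon> / 2 + (\<Sum>k<N. ln (norm (g (cis (2 * pi * real k / real N))) + \<delta>)) / real N)"
    using \<epsilon> by (intro disc_log_mean g_cont g_hol \<delta>) auto
  then show ?thesis
    using eventually_gt_at_top[of 0]
  proof eventually_elim
    case (elim N)
    let ?\<zeta> = "\<lambda>k. cis (2 * pi * real k / real N)"
    let ?b = "\<lambda>k. ln (norm (h (strip_pt \<theta> N k)) + \<delta>)"
    have fin: "finite (left_pts \<theta> N)" "finite (right_pts \<theta> N)" "left_pts \<theta> N \<inter> right_pts \<theta> N = {}" 
      and sub: "left_pts \<theta> N \<union> right_pts \<theta> N \<subseteq> {..<N}"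
    proof -
      have "k < N" if "real k < \<theta> * real N" for k
      proof -
        have "\<theta> * real N \<le> 1 * real N" using \<theta> by (intro mult_right_mono) auto
        then show ?thesis using that by linarith
      qed
      then show sub: "left_pts \<theta> N \<union> right_pts \<theta> N \<subseteq> {..<N}"
        by (auto simp: left_pts_def right_pts_def)
      show "left_pts \<theta> N \<inter> right_pts \<theta> N = {}" by (auto simp: left_pts_def right_pts_def)
      show "finite (left_pts \<theta> N)" "finite (right_pts \<theta> N)" using sub finite_subset by blast+
    qed
    \<comment> \<open>The remaining indices belong to the two singular points; there \<open>ln \<delta> \<le> 0\<close> can be dropped.\<close>
    have ex: "g (?\<zeta> k) = 0" if "k \<in> {..<N} - (left_pts \<theta> N \<union> right_pts \<theta> N)" for k
    proof -
      have "k = 0 \<or> real k = \<theta> * real N" using that by (auto simp: left_pts_def right_pts_def)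
      then have "?\<zeta> k \<in> {1, a}" using elim by (auto simp: a_def mult_ac)
      then show ?thesis by (simp add: g_def)
    qed
    have "(\<Sum>k<N. ln (norm (g (?\<zeta> k)) + \<delta>)) = 
       (\<Sum>k\<in>left_pts \<theta> N \<union> right_pts \<theta> N. ln (norm (g (?\<zeta> k)) + \<delta>)) + 
       (\<Sum>k\<in>{..<N} - (left_pts \<theta> N \<union> right_pts \<theta> N). ln (norm (g (?\<zeta> k)) + \<delta>))"
      by (subst sum.subset_diff[OF sub]) auto
    also have "\<dots> \<le> (\<Sum>k\<in>left_pts \<theta> N \<union> right_pts \<theta> N. ?b k) + 0"
    proof (intro add_mono sum_mono sum_nonpos)
      fix k assume k: "k \<in> left_pts \<theta> N \<union> right_pts \<theta> N"
      have "norm (g (?\<zeta> k)) \<le> norm (h (strip_pt \<theta> N k))"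
        unfolding g_def strip_pt_def using mult_left_mono[OF \<kappa>_le[of "?\<zeta> k"], of "norm (h (strip_map \<theta> (?\<zeta> k)))"] by (auto simp: norm_mult)
      then show "ln (norm (g (?\<zeta> k)) + \<delta>) \<le> ?b k" using \<delta> by (intro ln_mono) (auto intro: add_nonneg_pos)
    qed (use ex \<delta> in auto)
    also have "\<dots> = (\<Sum>k\<in>left_pts \<theta> N. ?b k) + (\<Sum>k\<in>right_pts \<theta> N. ?b k)"
      using fin by (simp add: sum.union_disjoint)
    finally have "exp (\<epsilon> / 2 + (\<Sum>k<N. ln (norm (g (?\<zeta> k)) + \<delta>)) / real N) \<le> 
        exp (\<epsilon> / 2 + ((\<Sum>k\<in>left_pts \<theta> N. ?b k) + (\<Sum>k\<in>right_pts \<theta> N. ?b k)) / real N)"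
      by (simp add: divide_right_mono)
    from order_trans[OF elim(1) this] have "norm (g 0) * exp (\<epsilon> / 2) \<le> 
        exp (\<epsilon> / 2 + ((\<Sum>k\<in>left_pts \<theta> N. ?b k) + (\<Sum>k\<in>right_pts \<theta> N. ?b k)) / real N) * exp (\<epsilon> / 2)"
      by (rule mult_right_mono) simp
    also have "\<dots> = exp (\<epsilon> + ((\<Sum>k\<in>left_pts \<theta> N. ?b k) + (\<Sum>k\<in>right_pts \<theta> N. ?b k)) / real N)"
      unfolding exp_add[symmetric] by (simp add: algebra_simps)
    finally show ?case using h_le by linarith
  qed
qed

lemma strip_pt_on_lines:
  assumes \<theta>: "0 < \<theta>" "\<theta> < 1"
  shows "k \<in> left_pts \<theta> N \<Longrightarrow> Re (strip_pt \<theta> N k) = 0"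
    and "k \<in> right_pts \<theta> N \<Longrightarrow> Re (strip_pt \<theta> N k) = 1"
proof -
  assume k: "k \<in> left_pts \<theta> N"
  then have "0 < N" by (cases N) (auto simp: left_pts_def)
  moreover have "0 \<le> \<theta> * real N" using \<theta> by simp
  then have "0 < real k" using k unfolding left_pts_def mem_Collect_eq by linarith
  ultimately have t: "0 < real k / real N" "real k / real N < 1" "\<theta> < real k / real N"
    using k by (auto simp: left_pts_def field_simps)
  show "Re (strip_pt \<theta> N k) = 0"
    using Re_strip_map_circle(2)[OF \<theta> t] unfolding strip_pt_def by simp
next
  assume k: "k \<in> right_pts \<theta> N"
  then have "0 < N" by (cases N) (auto simp: right_pts_def)
  with k \<theta> have t: "0 < real k / real N" "real k / real N < \<theta>"
    by (auto simp: right_pts_def field_simps)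
  then show "Re (strip_pt \<theta> N k) = 1"
    using Re_strip_map_circle(1)[OF \<theta> t(1) _ t(2)] \<theta> unfolding strip_pt_def by simp
qed

lemma card_pts_limit:
  assumes \<theta>: "0 < \<theta>" "\<theta> < 1"
  shows "(\<lambda>N. card (left_pts \<theta> N) / N) \<longlonglongrightarrow> 1 - \<theta>" "(\<lambda>N. card (right_pts \<theta> N) / N) \<longlonglongrightarrow> \<theta>"
proof -
  have R: "\<bar>card (right_pts \<theta> N) - \<theta> * N\<bar> \<le> 1" for N
  proof (cases "N = 0")
    case False
    then have pos: "0 < \<theta> * N" using \<theta> by simp
    define n where "n = nat (\<lceil>\<theta> * N\<rceil> - 1)"
    have n: "real n < \<theta> * N" "\<theta> * N \<le> real n + 1"
      unfolding n_def using pos by linarith+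
    have "right_pts \<theta> N = {1..n}"
    proof (intro set_eqI)
      fix k show "k \<in> right_pts \<theta> N \<longleftrightarrow> k \<in> {1..n}"
        unfolding right_pts_def using n by auto
    qed
    then show ?thesis using n by simp
  qed (auto simp: right_pts_def)
  have L: "\<bar>card (left_pts \<theta> N) - (1 - \<theta>) * N\<bar> \<le> 1" for N
  proof -
    define n where "n = nat \<lfloor>\<theta> * N\<rfloor>"
    have n: "real n \<le> \<theta> * N" "\<theta> * N < real n + 1"
      unfolding n_def using \<theta> by (auto simp: of_nat_nat)
    have "\<theta> * real N \<le> 1 * real N" using \<theta> by (intro mult_right_mono) auto
    then have "n \<le> N" using n by simp
    have "left_pts \<theta> N = {n<..<N}"
    proof (intro set_eqI)
      fix k show "k \<in> left_pts \<theta> N \<longleftrightarrow> k \<in> {n<..<N}"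
        unfolding left_pts_def using n by auto
    qed
    then have "card (left_pts \<theta> N) = N - Suc n" by simp
    then show ?thesis using n \<open>n \<le> N\<close> \<theta> by (cases "n = N") (auto simp: of_nat_diff algebra_simps)
  qed
  have lim: "(\<lambda>N. f N / N) \<longlonglongrightarrow> c" if "\<And>N. \<bar>f N - c * real N\<bar> \<le> 1" for f :: "nat \<Rightarrow> real" and c
  proof (rule LIM_zero_cancel, rule Lim_null_comparison)
    show "\<forall>\<^sub>F N in sequentially. norm (f N / real N - c) \<le> 1 / real N"
      using eventually_gt_at_top[of 0]
    proof eventually_elim
      case (elim N)
      have "f N / real N - c = (f N - c * real N) / real N" using elim by (simp add: field_simps)
      then show ?case using that[of N] elim by (simp add: divide_right_mono)
    qed
    show "(\<lambda>N. 1 / real N) \<longlonglongrightarrow> 0" by (rule lim_1_over_n)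
  qed
  show "(\<lambda>N. card (left_pts \<theta> N) / N) \<longlonglongrightarrow> 1 - \<theta>" by (rule lim[OF L])
  show "(\<lambda>N. card (right_pts \<theta> N) / N) \<longlonglongrightarrow> \<theta>" by (rule lim[OF R])
qed

text \<open>
  The arithmetic-geometric mean inequality for the numbers \<open>x k powr s\<close>.
\<close>

lemma sum_ln_le_ln_power_mean:
  fixes x :: "'k \<Rightarrow> real"
  assumes K: "finite K" "K \<noteq> {}" and x: "\<And>k. k \<in> K \<Longrightarrow> 0 < x k" and s: "0 < s"
  shows "(\<Sum>k\<in>K. ln (x k)) \<le> card K * (ln ((\<Sum>k\<in>K. x k powr s) / card K) / s)"
proof -
  have n: "0 < card K" using K by (simp add: card_gt_0_iff)
  have "(\<Prod>k\<in>K. x k powr s) powr (1 / card K) \<le> (\<Sum>k\<in>K. x k powr s / card K)"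
    using K by (intro arith_geom_mean) auto
  moreover have pos: "0 < (\<Prod>k\<in>K. x k powr s)" using x by (intro prod_pos) (metis powr_gt_zero less_irrefl)
  ultimately have "ln ((\<Prod>k\<in>K. x k powr s) powr (1 / card K)) \<le> ln (\<Sum>k\<in>K. x k powr s / card K)"
    by (intro ln_mono) auto
  also have "ln ((\<Prod>k\<in>K. x k powr s) powr (1 / card K)) = (\<Sum>k\<in>K. s * ln (x k)) / card K"
  proof -
    have "ln (\<Prod>k\<in>K. x k powr s) = (\<Sum>k\<in>K. ln (x k powr s))"
      using K x by (intro ln_prod) (metis powr_gt_zero less_irrefl)+
    also have "\<dots> = (\<Sum>k\<in>K. s * ln (x k))"
      using x by (intro sum.cong refl) (simp add: ln_powr)
    finally show ?thesis by (simp add: ln_powr)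
  qed
  finally show ?thesis
    using s n by (simp add: sum_divide_distrib[symmetric] sum_distrib_left[symmetric] field_simps)
qed

text \<open>
  The points on one line carry only approximately the mass \<open>\<tau>\<close>. The shift by \<open>\<delta>\<close> keeps the logarithm of the
  power mean between \<open>ln \<delta>\<close> and \<open>ln (C + 1)\<close>, so replacing the proportion \<open>card K / N\<close> by \<open>\<tau>\<close> costs little.
\<close>

lemma log_sum_le_log_power_mean:
  fixes b :: "'k \<Rightarrow> real" and N :: nat
  assumes K: "finite K" "K \<noteq> {}" and b: "\<And>k. k \<in> K \<Longrightarrow> 0 \<le> b k" "\<And>k. k \<in> K \<Longrightarrow> b k \<le> C" 
    and C: "0 \<le> C" and \<delta>: "0 < \<delta>" "\<delta> \<le> 1" and s: "0 < s" and N: "0 < N"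
    and close: "\<bar>card K / N - \<tau>\<bar> * (\<bar>ln \<delta>\<bar> + ln (C + 1)) \<le> \<rho>"
  shows "(\<Sum>k\<in>K. ln (b k + \<delta>)) / N \<le> \<tau> / s * ln ((\<Sum>k\<in>K. (b k + \<delta>) powr s) / card K) + \<rho>"
proof -
  define X where "X = (\<Sum>k\<in>K. (b k + \<delta>) powr s) / card K"
  have n: "0 < card K" using K by (simp add: card_gt_0_iff)
  have "(\<Sum>k\<in>K. \<delta> powr s) \<le> (\<Sum>k\<in>K. (b k + \<delta>) powr s)"
    using b \<delta> s by (intro sum_mono powr_mono2) auto
  then have X1: "\<delta> powr s \<le> X" unfolding X_def using n by (simp add: field_simps)
  have "b k + \<delta> \<le> C + 1" if "k \<in> K" for k using b(2)[OF that] \<delta> by linarith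
  then have "(\<Sum>k\<in>K. (b k + \<delta>) powr s) \<le> (\<Sum>k\<in>K. (C + 1) powr s)"
    using b \<delta> s by (intro sum_mono powr_mono2) (auto intro: add_nonneg_nonneg)
  then have X2: "X \<le> (C + 1) powr s" unfolding X_def using n by (simp add: field_simps)
  have X0: "0 < X" using X1 \<delta> by (smt (verit) powr_gt_zero)
  have "ln (\<delta> powr s) \<le> ln X" "ln X \<le> ln ((C + 1) powr s)"
    using X1 X2 X0 \<delta> C by (auto intro!: iffD2[OF ln_le_cancel_iff] simp del: ln_powr)
  then have "ln \<delta> \<le> ln X / s" "ln X / s \<le> ln (C + 1)"
    using s \<delta> C by (simp_all add: ln_powr field_simps)
  moreover have "0 \<le> ln (C + 1)" using C by simp
  ultimately have B: "\<bar>ln X / s\<bar> \<le> \<bar>ln \<delta>\<bar> + ln (C + 1)" by linarith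
  have "(\<Sum>k\<in>K. ln (b k + \<delta>)) \<le> card K * (ln X / s)"
    unfolding X_def using b \<delta> by (intro sum_ln_le_ln_power_mean K s) (auto intro: add_nonneg_pos)
  then have "(\<Sum>k\<in>K. ln (b k + \<delta>)) / N \<le> card K / N * (ln X / s)"
    using N by (simp add: field_simps)
  also have "\<dots> = \<tau> * (ln X / s) + (card K / N - \<tau>) * (ln X / s)"
    by (simp add: algebra_simps)
  also have "(card K / N - \<tau>) * (ln X / s) \<le> \<bar>card K / N - \<tau>\<bar> * \<bar>ln X / s\<bar>"
    by (metis abs_ge_self abs_mult)
  also have "\<dots> \<le> \<bar>card K / N - \<tau>\<bar> * (\<bar>ln \<delta>\<bar> + ln (C + 1))"
    by (intro mult_left_mono B) auto
  also have "\<dots> \<le> \<rho>" by (rule close)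
  finally show ?thesis unfolding X_def by simp
qed

text \<open>
  For \<open>s > 1\<close> the power is not subadditive, so the effect of a shift is controlled by uniform continuity.
\<close>

lemma powr_shift_small:
  fixes C s \<eta> :: real
  assumes s: "0 < s" and \<eta>: "0 < \<eta>"
  shows "\<exists>d>0. \<forall>t \<delta>. 0 \<le> t \<longrightarrow> t \<le> C \<longrightarrow> 0 \<le> \<delta> \<longrightarrow> \<delta> \<le> d \<longrightarrow> (t + \<delta>) powr s \<le> t powr s + \<eta>"
proof -
  have "continuous_on {0..C + 1} (\<lambda>t. t powr s)"
    using s by (intro continuous_on_powr' continuous_intros) auto
  then have "uniformly_continuous_on {0..C + 1} (\<lambda>t. t powr s)"
    by (intro compact_uniformly_continuous) auto
  then obtain d where d: "d > 0" "\<And>t t'. t \<in> {0..C+1} \<Longrightarrow> t' \<in> {0..C+1} \<Longrightarrow> dist t' t < d \<Longrightarrow> dist (t' powr s) (t powr s) < \<eta>"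
    unfolding uniformly_continuous_on_def using \<eta> by blast
  show ?thesis
  proof (intro exI[of _ "min 1 (d / 2)"] conjI allI impI)
    show "0 < min 1 (d / 2)" using d by simp
    fix t \<delta> :: real assume *: "0 \<le> t" "t \<le> C" "0 \<le> \<delta>" "\<delta> \<le> min 1 (d / 2)"
    then have "dist ((t + \<delta>) powr s) (t powr s) < \<eta>"
      using d(1) by (intro d(2)) (auto simp: dist_real_def)
    then show "(t + \<delta>) powr s \<le> t powr s + \<eta>" unfolding dist_real_def by linarith
  qed
qed

text \<open>
  Exponentiating the logarithmic bound gives the claim up to the parameters \<open>\<eta>\<close> and \<open>\<delta>\<close>. These act on power
  means from a fixed bounded range, on which the right-hand side is uniformly continuous; hence a single
  choice of them works for all large \<open>N\<close>.
\<close>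

lemma strip_power_mean_eventually:
  assumes \<theta>: "0 < \<theta>" "\<theta> < 1" and h: "strip_bounded h" and s: "0 < s0" "0 < s1" and e: "0 < e"
  defines "X \<equiv> \<lambda>N. (\<Sum>k\<in>left_pts \<theta> N. norm (h (strip_pt \<theta> N k)) powr s0) / card (left_pts \<theta> N)"
  defines "Y \<equiv> \<lambda>N. (\<Sum>k\<in>right_pts \<theta> N. norm (h (strip_pt \<theta> N k)) powr s1) / card (right_pts \<theta> N)"
  shows "\<forall>\<^sub>F N in sequentially. norm (h \<theta>) \<le> X N powr ((1 - \<theta>) / s0) * Y N powr (\<theta> / s1) + e"
proof -
  obtain C where C: "\<And>z. 0 \<le> Re z \<Longrightarrow> Re z \<le> 1 \<Longrightarrow> norm (h z) \<le> C" and C0: "0 < C"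
    using h unfolding strip_bounded_def bounded_pos by auto
  define \<alpha> where "\<alpha> = (1 - \<theta>) / s0"
  define \<beta> where "\<beta> = \<theta> / s1"
  have ab: "0 < \<alpha>" "0 < \<beta>" using \<theta> s by (auto simp: \<alpha>_def \<beta>_def)
  \<comment> \<open>\<open>G (\<eta>, X + \<eta>, Y + \<eta>)\<close> will be the perturbed bound and \<open>G (0, X, Y)\<close> the desired one.\<close>
  define G where "G = (\<lambda>(x :: real, u, v). exp (2 * x) * (u powr \<alpha> * v powr \<beta>))"
  define S where "S = {0..1::real} \<times> {0..C powr s0 + 1} \<times> {0..C powr s1 + 1}"
  have "continuous_on S G"
    unfolding G_def S_def case_prod_unfold using ab
    by (intro continuous_intros continuous_on_powr') auto
  moreover have "compact S" unfolding S_def by (intro compact_Times) auto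
  ultimately have "uniformly_continuous_on S G" by (rule compact_uniformly_continuous)
  then obtain d where d: "d > 0" "\<And>x y. x \<in> S \<Longrightarrow> y \<in> S \<Longrightarrow> dist y x < d \<Longrightarrow> dist (G y) (G x) < e"
    unfolding uniformly_continuous_on_def using e by blast
  define \<eta> where "\<eta> = min 1 (d / 4)"
  have \<eta>: "0 < \<eta>" "\<eta> \<le> 1" "3 * \<eta> < d" using d(1) by (auto simp: \<eta>_def)
  have G: "G (\<eta>, u + \<eta>, v + \<eta>) \<le> G (0, u, v) + e" if "0 \<le> u" "u \<le> C powr s0" "0 \<le> v" "v \<le> C powr s1" for u v
  proof -
    have "dist (\<eta>, u + \<eta>, v + \<eta>) (0, u, v) \<le> \<bar>\<eta>\<bar> + (\<bar>\<eta>\<bar> + \<bar>\<eta>\<bar>)"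
      unfolding dist_Pair_Pair by (rule order_trans[OF sqrt_sum_squares_le_sum_abs])
        (simp, rule order_trans[OF sqrt_sum_squares_le_sum_abs], simp add: dist_real_def)
    then have "dist (G (\<eta>, u + \<eta>, v + \<eta>)) (G (0, u, v)) < e"
      using \<eta> that by (intro d(2)) (auto simp: S_def)
    then show ?thesis unfolding dist_real_def by linarith
  qed
  obtain d0 where d0: "d0 > 0" "\<And>t \<delta>. 0 \<le> t \<Longrightarrow> t \<le> C \<Longrightarrow> 0 \<le> \<delta> \<Longrightarrow> \<delta> \<le> d0 \<Longrightarrow> (t + \<delta>) powr s0 \<le> t powr s0 + \<eta>"
    using powr_shift_small[OF s(1) \<eta>(1), of C] by blast
  obtain d1 where d1: "d1 > 0" "\<And>t \<delta>. 0 \<le> t \<Longrightarrow> t \<le> C \<Longrightarrow> 0 \<le> \<delta> \<Longrightarrow> \<delta> \<le> d1 \<Longrightarrow> (t + \<delta>) powr s1 \<le> t powr s1 + \<eta>"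
    using powr_shift_small[OF s(2) \<eta>(1), of C] by blast
  define \<delta> where "\<delta> = min 1 (min d0 d1)"
  have \<delta>: "0 < \<delta>" "\<delta> \<le> 1" "\<delta> \<le> d0" "\<delta> \<le> d1" using d0(1) d1(1) by (auto simp: \<delta>_def)
  define B where "B = \<bar>ln \<delta>\<bar> + ln (C + 1)"
  have "(\<lambda>N. \<bar>card (left_pts \<theta> N) / N - (1 - \<theta>)\<bar> * B) \<longlonglongrightarrow> \<bar>(1 - \<theta>) - (1 - \<theta>)\<bar> * B"
    by (intro tendsto_intros card_pts_limit \<theta>)
  then have evL: "\<forall>\<^sub>F N in sequentially. \<bar>card (left_pts \<theta> N) / N - (1 - \<theta>)\<bar> * B < \<eta> / 2"
    by (rule order_tendstoD) (use \<eta> in auto)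
  have "(\<lambda>N. \<bar>card (right_pts \<theta> N) / N - \<theta>\<bar> * B) \<longlonglongrightarrow> \<bar>\<theta> - \<theta>\<bar> * B"
    by (intro tendsto_intros card_pts_limit \<theta>)
  then have evR: "\<forall>\<^sub>F N in sequentially. \<bar>card (right_pts \<theta> N) / N - \<theta>\<bar> * B < \<eta> / 2"
    by (rule order_tendstoD) (use \<eta> in auto)
  have evL0: "\<forall>\<^sub>F N in sequentially. 0 < card (left_pts \<theta> N) / N"
    by (rule order_tendstoD[OF card_pts_limit(1)]) (use \<theta> in auto)
  have evR0: "\<forall>\<^sub>F N in sequentially. 0 < card (right_pts \<theta> N) / N"
    by (rule order_tendstoD[OF card_pts_limit(2)]) (use \<theta> in auto)
  show ?thesis
    using strip_log_mean[OF \<theta> h \<delta>(1,2) \<eta>(1)] evL evR evL0 evR0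
  proof eventually_elim
    case (elim N)
    define b where "b = (\<lambda>k. norm (h (strip_pt \<theta> N k)))"
    let ?L = "left_pts \<theta> N" and ?R = "right_pts \<theta> N"
    have N: "0 < N" and KL: "finite ?L" "?L \<noteq> {}" "0 < card ?L" and KR: "finite ?R" "?R \<noteq> {}" "0 < card ?R"
      using elim by (auto simp: zero_less_divide_iff card_gt_0_iff)
    have b0: "0 \<le> b k" for k by (simp add: b_def)
    have bL: "b k \<le> C" if "k \<in> ?L" for k
      unfolding b_def using strip_pt_on_lines(1)[OF \<theta> that] by (intro C) auto
    have bR: "b k \<le> C" if "k \<in> ?R" for k
      unfolding b_def using strip_pt_on_lines(2)[OF \<theta> that] by (intro C) auto
    have XB: "X N = (\<Sum>k\<in>?L. b k powr s0) / card ?L" and YB: "Y N = (\<Sum>k\<in>?R. b k powr s1) / card ?R"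
      by (simp_all add: X_def Y_def b_def)
    define X' where "X' = (\<Sum>k\<in>?L. (b k + \<delta>) powr s0) / card ?L"
    define Y' where "Y' = (\<Sum>k\<in>?R. (b k + \<delta>) powr s1) / card ?R"
    have pos: "0 < X'" "0 < Y'"
      unfolding X'_def Y'_def using KL KR b0 \<delta> 
      by (auto intro!: divide_pos_pos sum_pos simp: add_nonneg_pos less_imp_neq[symmetric])
    have XX: "X' \<le> X N + \<eta>"
    proof -
      have "(\<Sum>k\<in>?L. (b k + \<delta>) powr s0) \<le> (\<Sum>k\<in>?L. b k powr s0 + \<eta>)"
        using b0 bL \<delta> by (intro sum_mono d0) auto
      then show ?thesis unfolding X'_def XB using KL by (simp add: sum.distrib field_simps)
    qed
    have YY: "Y' \<le> Y N + \<eta>"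
    proof -
      have "(\<Sum>k\<in>?R. (b k + \<delta>) powr s1) \<le> (\<Sum>k\<in>?R. b k powr s1 + \<eta>)"
        using b0 bR \<delta> by (intro sum_mono d1) auto
      then show ?thesis unfolding Y'_def YB using KR by (simp add: sum.distrib field_simps)
    qed
    have XN: "0 \<le> X N" "X N \<le> C powr s0"
    proof -
      show "0 \<le> X N" unfolding X_def by (intro divide_nonneg_nonneg sum_nonneg) auto
      have "(\<Sum>k\<in>?L. b k powr s0) \<le> (\<Sum>k\<in>?L. C powr s0)"
        using b0 bL s by (intro sum_mono powr_mono2) auto
      then show "X N \<le> C powr s0" unfolding XB using KL by (simp add: field_simps)
    qed
    have YN: "0 \<le> Y N" "Y N \<le> C powr s1"
    proof -
      show "0 \<le> Y N" unfolding Y_def by (intro divide_nonneg_nonneg sum_nonneg) auto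
      have "(\<Sum>k\<in>?R. b k powr s1) \<le> (\<Sum>k\<in>?R. C powr s1)"
        using b0 bR s by (intro sum_mono powr_mono2) auto
      then show "Y N \<le> C powr s1" unfolding YB using KR by (simp add: field_simps)
    qed
    have "(\<Sum>k\<in>?L. ln (b k + \<delta>)) / N \<le> (1 - \<theta>) / s0 * ln X' + \<eta> / 2"
      unfolding X'_def using elim(2) C0 by (intro log_sum_le_log_power_mean[where C = C] KL b0 bL \<delta> s N) (auto simp: B_def)
    moreover have "(\<Sum>k\<in>?R. ln (b k + \<delta>)) / N \<le> \<theta> / s1 * ln Y' + \<eta> / 2"
      unfolding Y'_def using elim(3) C0 by (intro log_sum_le_log_power_mean[where C = C] KR b0 bR \<delta> s N) (auto simp: B_def)
    ultimately have "\<eta> + ((\<Sum>k\<in>?L. ln (b k + \<delta>)) + (\<Sum>k\<in>?R. ln (b k + \<delta>))) / N \<le> 2 * \<eta> + (\<alpha> * ln X' + \<beta> * ln Y')"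
      unfolding \<alpha>_def \<beta>_def by (simp add: add_divide_distrib)
    then have "norm (h \<theta>) \<le> exp (2 * \<eta> + (\<alpha> * ln X' + \<beta> * ln Y'))"
      using elim(1) unfolding b_def by (meson exp_le_cancel_iff order_trans)
    also have "\<dots> = exp (2 * \<eta>) * (X' powr \<alpha> * Y' powr \<beta>)"
      using pos by (simp add: exp_add powr_def)
    also have "\<dots> \<le> exp (2 * \<eta>) * ((X N + \<eta>) powr \<alpha> * (Y N + \<eta>) powr \<beta>)"
      using pos ab XX YY by (intro mult_left_mono mult_mono powr_mono2) auto
    also have "\<dots> = G (\<eta>, X N + \<eta>, Y N + \<eta>)" by (simp add: G_def)
    also have "\<dots> \<le> G (0, X N, Y N) + e" by (intro G XN YN)
    finally show ?case by (simp add: G_def \<alpha>_def \<beta>_def)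
  qed
qed

text \<open>
  The pointwise form of the three lines theorem that survives integration: both exponents \<open>s0\<close> and \<open>s1\<close>
  are free, and for fixed \<open>N\<close> the right-hand side involves finitely many values of \<open>h\<close> on the two lines, at
  points that do not depend on \<open>h\<close>.
\<close>

lemma strip_power_mean_liminf:
  assumes \<theta>: "0 < \<theta>" "\<theta> < 1" and h: "strip_bounded h" and s: "0 < s0" "0 < s1"
  shows "ennreal (norm (h \<theta>)) \<le> liminf (\<lambda>N. 
     epowr (power_mean (left_pts \<theta> N) s0 (\<lambda>k. ennreal (norm (h (strip_pt \<theta> N k))))) (1 - \<theta>) *
     epowr (power_mean (right_pts \<theta> N) s1 (\<lambda>k. ennreal (norm (h (strip_pt \<theta> N k))))) \<theta>)"
proof -
  define X where "X N = (\<Sum>k\<in>left_pts \<theta> N. norm (h (strip_pt \<theta> N k)) powr s0) / card (left_pts \<theta> N)" for N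
  define Y where "Y N = (\<Sum>k\<in>right_pts \<theta> N. norm (h (strip_pt \<theta> N k)) powr s1) / card (right_pts \<theta> N)" for N
  define Z where "Z N = X N powr ((1 - \<theta>) / s0) * Y N powr (\<theta> / s1)" for N
  have X0: "0 \<le> X N" and Y0: "0 \<le> Y N" for N 
    unfolding X_def Y_def by (auto intro!: divide_nonneg_nonneg sum_nonneg)
  have pm: "power_mean K s (\<lambda>k. ennreal (norm (f k))) = ennreal (((\<Sum>k\<in>K. norm (f k) powr s) / card K) powr (1 / s))"
    for K :: "nat set" and s and f :: "nat \<Rightarrow> complex"
    unfolding power_mean_def 
    by (simp add: epowr_ennreal sum_nonneg sum_ennreal divide_nonneg_nonneg flip: ennreal_mult)
  have "epowr (power_mean (left_pts \<theta> N) s0 (\<lambda>k. ennreal (norm (h (strip_pt \<theta> N k))))) (1 - \<theta>) *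
     epowr (power_mean (right_pts \<theta> N) s1 (\<lambda>k. ennreal (norm (h (strip_pt \<theta> N k))))) \<theta> = ennreal (Z N)" for N
    unfolding pm X_def[symmetric] Y_def[symmetric] Z_def
    using X0[of N] Y0[of N] by (simp add: epowr_ennreal powr_powr flip: ennreal_mult)
  moreover have "ennreal (norm (h \<theta>)) \<le> liminf (\<lambda>N. ennreal (Z N))"
    unfolding le_Liminf_iff
  proof (intro allI impI)
    fix y assume y: "y < ennreal (norm (h \<theta>))"
    then obtain y' where y': "y = ennreal y'" "0 \<le> y'" by (metis ennreal_cases not_less top_greatest)
    then have "0 < (norm (h \<theta>) - y') / 2" using y by (simp add: ennreal_less_iff)
    from strip_power_mean_eventually[OF \<theta> h s this]
    show "\<forall>\<^sub>F N in sequentially. y < ennreal (Z N)"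
    proof eventually_elim
      case (elim N)
      then have "norm (h \<theta>) \<le> Z N + (norm (h \<theta>) - y') / 2" unfolding Z_def X_def Y_def .
      then have "y' < Z N" using y y' by (simp add: ennreal_less_iff field_simps)
      then show ?case using y' by (simp add: ennreal_less_iff)
    qed
  qed
  ultimately show ?thesis by simp
qed

section \<open>The three lines theorem for mixed norms\<close>

text \<open>
  The interpolation step is applied to the inner norm at each fixed \<open>x\<close> and then to the outer norm. In
  between stands a lower limit of power means of the inner norms of \<open>G z\<close> for \<open>z\<close> on the two lines, and these
  are measurable in \<open>x\<close> by assumption, although inner norms of other functions on the product need not be.
\<close>

lemma three_lines_mixed_norm:
  fixes G :: "complex \<Rightarrow> 'b \<times> 'c \<Rightarrow> complex"
  assumes \<theta>: "0 < \<theta>" "\<theta> < 1" and pos: "0 < pt0" "0 < qt0" "0 < p0" "0 < q0"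
    and rt0: "1 / rt0 = (1 - \<theta>) / pt0 + \<theta> / qt0" and r0: "1 / r0 = (1 - \<theta>) / p0 + \<theta> / q0"
    and [measurable]: "w0 \<in> borel_measurable N" "v0 \<in> borel_measurable N"
    and u0: "\<And>x. x \<in> space N \<Longrightarrow> u0 x = epowr (w0 x) (1 - \<theta>) * epowr (v0 x) \<theta>"
    and strip: "\<And>xy. xy \<in> space (N \<Otimes>\<^sub>M Nt) \<Longrightarrow> strip_bounded (\<lambda>z. G z xy)"
    and meas: "\<And>z. G z \<in> borel_measurable (N \<Otimes>\<^sub>M Nt)"
    and meas0: "\<And>z. Re z = 0 \<Longrightarrow> inner_int Nt pt0 (G z) \<in> borel_measurable N"
    and meas1: "\<And>z. Re z = 1 \<Longrightarrow> inner_int Nt qt0 (G z) \<in> borel_measurable N"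
    and bound0: "\<And>z. Re z = 0 \<Longrightarrow> mixed_norm N Nt p0 pt0 w0 (G z) \<le> \<Lambda>0"
    and bound1: "\<And>z. Re z = 1 \<Longrightarrow> mixed_norm N Nt q0 qt0 v0 (G z) \<le> \<Lambda>1"
  shows "mixed_norm N Nt r0 rt0 u0 (G \<theta>) \<le> epowr \<Lambda>0 (1 - \<theta>) * epowr \<Lambda>1 \<theta>"
proof -
  have "0 < (1 - \<theta>) / pt0 + \<theta> / qt0" "0 < (1 - \<theta>) / p0 + \<theta> / q0"
    using \<theta> pos by (auto intro!: add_pos_pos)
  then have r: "0 < rt0" "0 < r0" using rt0 r0 by (metis zero_less_divide_1_iff)+
  \<comment> \<open>Below both the inner and the outer exponent, so that Minkowski applies at both levels.\<close>
  define s0 where "s0 = min p0 pt0"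
  define s1 where "s1 = min q0 qt0"
  have s: "0 < s0" "s0 \<le> p0" "s0 \<le> pt0" "0 < s1" "s1 \<le> q0" "s1 \<le> qt0"
    using pos by (auto simp: s0_def s1_def)
  let ?Lf = "left_pts \<theta>" and ?Rt = "right_pts \<theta>" and ?\<zeta> = "strip_pt \<theta>"
  define A where "A z x = qnorm Nt pt0 (\<lambda>y. ennreal (norm (G z (x, y))))" for z x
  define B where "B z x = qnorm Nt qt0 (\<lambda>y. ennreal (norm (G z (x, y))))" for z x
  have sec: "(\<lambda>y. ennreal (norm (G z (x, y)))) \<in> borel_measurable Nt" if "x \<in> space N" for x z
    using measurable_compose[OF measurable_Pair1'[OF that] meas[of z]] by simp
  have A_meas: "A z \<in> borel_measurable N" if "Re z = 0" for z
  proof -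
    have "A z = (\<lambda>x. epowr (inner_int Nt pt0 (G z) x) (1 / pt0))"
      by (simp add: A_def qnorm_def inner_int_def epowr_ennreal fun_eq_iff)
    then show ?thesis using meas0[OF that] by simp
  qed
  have B_meas: "B z \<in> borel_measurable N" if "Re z = 1" for z
  proof -
    have "B z = (\<lambda>x. epowr (inner_int Nt qt0 (G z) x) (1 / qt0))"
      by (simp add: B_def qnorm_def inner_int_def epowr_ennreal fun_eq_iff)
    then show ?thesis using meas1[OF that] by simp
  qed
  have inner: "qnorm Nt rt0 (\<lambda>y. ennreal (norm (G \<theta> (x, y)))) \<le> 
      liminf (\<lambda>n. epowr (power_mean (?Lf n) s0 (\<lambda>k. A (?\<zeta> n k) x)) (1 - \<theta>) 
                * epowr (power_mean (?Rt n) s1 (\<lambda>k. B (?\<zeta> n k) x)) \<theta>)" if x: "x \<in> space N" for x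
    unfolding A_def B_def
  proof (rule qnorm_interpolation_step[OF \<theta> pos(1,2) rt0 s(1,3,4,6)])
    fix y assume "y \<in> space Nt"
    then have "(x, y) \<in> space (N \<Otimes>\<^sub>M Nt)" using x by (simp add: space_pair_measure)
    from strip_power_mean_liminf[OF \<theta> strip[OF this] s(1,4)]
    show "ennreal (norm (G \<theta> (x, y))) \<le> liminf (\<lambda>n. 
        epowr (power_mean (?Lf n) s0 (\<lambda>k. ennreal (norm (G (?\<zeta> n k) (x, y))))) (1 - \<theta>) *
        epowr (power_mean (?Rt n) s1 (\<lambda>k. ennreal (norm (G (?\<zeta> n k) (x, y))))) \<theta>)" .
  qed (use sec[OF x] in auto)
  have "mixed_norm N Nt r0 rt0 u0 (G \<theta>) = qnorm N r0 (\<lambda>x. qnorm Nt rt0 (\<lambda>y. ennreal (norm (G \<theta> (x, y)))) * u0 x)"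
    by (rule mixed_norm_eq_qnorm[OF r(2,1)])
  also have "\<dots> \<le> liminf (\<lambda>n. epowr (power_mean (?Lf n) s0 (\<lambda>k. qnorm N p0 (\<lambda>x. A (?\<zeta> n k) x * w0 x))) (1 - \<theta>)
                * epowr (power_mean (?Rt n) s1 (\<lambda>k. qnorm N q0 (\<lambda>x. B (?\<zeta> n k) x * v0 x))) \<theta>)"
  proof (rule qnorm_interpolation_step[OF \<theta> pos(3,4) r0 s(1,2,4,5)])
    fix x assume x: "x \<in> space N"
    have "qnorm Nt rt0 (\<lambda>y. ennreal (norm (G \<theta> (x, y)))) * u0 x \<le> 
        liminf (\<lambda>n. epowr (power_mean (?Lf n) s0 (\<lambda>k. A (?\<zeta> n k) x)) (1 - \<theta>) 
                * epowr (power_mean (?Rt n) s1 (\<lambda>k. B (?\<zeta> n k) x)) \<theta>) * u0 x"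
      by (intro mult_right_mono inner x) simp
    also have "\<dots> \<le> liminf (\<lambda>n. epowr (power_mean (?Lf n) s0 (\<lambda>k. A (?\<zeta> n k) x)) (1 - \<theta>) 
                * epowr (power_mean (?Rt n) s1 (\<lambda>k. B (?\<zeta> n k) x)) \<theta> * u0 x)"
      by (rule ennreal_mult_Liminf_le)
    also have "\<dots> = liminf (\<lambda>n. epowr (power_mean (?Lf n) s0 (\<lambda>k. A (?\<zeta> n k) x * w0 x)) (1 - \<theta>)
                * epowr (power_mean (?Rt n) s1 (\<lambda>k. B (?\<zeta> n k) x * v0 x)) \<theta>)"
      unfolding u0[OF x] power_mean_mult[OF s(1)] power_mean_mult[OF s(4)] epowr_mult by (simp only: mult_ac)
    finally show "qnorm Nt rt0 (\<lambda>y. ennreal (norm (G \<theta> (x, y)))) * u0 x \<le> \<dots>" .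
  next
    fix n k
    show "(\<lambda>x. A (?\<zeta> n k) x * w0 x) \<in> borel_measurable N" if "k \<in> ?Lf n"
      using A_meas[OF strip_pt_on_lines(1)[OF \<theta> that]] by simp
    show "(\<lambda>x. B (?\<zeta> n k) x * v0 x) \<in> borel_measurable N" if "k \<in> ?Rt n"
      using B_meas[OF strip_pt_on_lines(2)[OF \<theta> that]] by simp
  qed
  also have "\<dots> \<le> epowr \<Lambda>0 (1 - \<theta>) * epowr \<Lambda>1 \<theta>"
  proof (intro Liminf_le always_eventually allI)
    fix n
    have "qnorm N p0 (\<lambda>x. A (?\<zeta> n k) x * w0 x) \<le> \<Lambda>0" if "k \<in> ?Lf n" for k
      using bound0[OF strip_pt_on_lines(1)[OF \<theta> that]] pos by (simp add: mixed_norm_eq_qnorm A_def)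
    moreover have "qnorm N q0 (\<lambda>x. B (?\<zeta> n k) x * v0 x) \<le> \<Lambda>1" if "k \<in> ?Rt n" for k
      using bound1[OF strip_pt_on_lines(2)[OF \<theta> that]] pos by (simp add: mixed_norm_eq_qnorm B_def)
    ultimately show "epowr (power_mean (?Lf n) s0 (\<lambda>k. qnorm N p0 (\<lambda>x. A (?\<zeta> n k) x * w0 x))) (1 - \<theta>)
                * epowr (power_mean (?Rt n) s1 (\<lambda>k. qnorm N q0 (\<lambda>x. B (?\<zeta> n k) x * v0 x))) \<theta>
           \<le> epowr \<Lambda>0 (1 - \<theta>) * epowr \<Lambda>1 \<theta>"
      using \<theta> s by (intro mult_mono epowr_mono power_mean_le) auto
  qed simp
  finally show ?thesis .
qed

section \<open>Families of test functions with balanced norms\<close>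

text \<open>
  Separating the norm from the product of function and weight leaves only nonnegative functions to deal with.
\<close>

definition Lebesgue_norm :: "'a measure \<Rightarrow> ennreal \<Rightarrow> ('a \<Rightarrow> ennreal) \<Rightarrow> ennreal" where
  "Lebesgue_norm M p g = (if p = \<infinity> then esssup M g else qnorm M (enn2real p) g)"

lemma Lp_norm_eq: "Lp_norm M p w f = Lebesgue_norm M p (\<lambda>x. ennreal (norm (f x)) * w x)"
  by (simp add: Lp_norm_def Lebesgue_norm_def qnorm_def)

lemma exponent_pos: "(1::ennreal) \<le> p \<Longrightarrow> p \<noteq> \<infinity> \<Longrightarrow> 1 \<le> enn2real p"
  by (cases p) auto

lemma Lebesgue_norm_mono:
  assumes p: "1 \<le> p" and f: "f \<in> borel_measurable M" and fg: "AE x in M. f x \<le> g x"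
  shows "Lebesgue_norm M p f \<le> Lebesgue_norm M p g"
  using esssup_AE_mono[OF f fg] qnorm_mono[OF _ fg, of "enn2real p"] exponent_pos[OF p] 
  by (auto simp: Lebesgue_norm_def)

lemma Lebesgue_norm_triangle:
  assumes p: "1 \<le> p" and [measurable]: "f \<in> borel_measurable M" "g \<in> borel_measurable M"
  shows "Lebesgue_norm M p (\<lambda>x. f x + g x) \<le> Lebesgue_norm M p f + Lebesgue_norm M p g"
proof (cases "p = \<infinity>")
  case True
  have "AE x in M. f x + g x \<le> esssup M f + esssup M g"
    using esssup_AE[of f M] esssup_AE[of g M] by eventually_elim (rule add_mono)
  then have "esssup M (\<lambda>x. f x + g x) \<le> esssup M f + esssup M g" by (intro esssup_I) auto
  then show ?thesis using True by (simp add: Lebesgue_norm_def)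
qed (simp add: Lebesgue_norm_def qnorm_triangle exponent_pos[OF p])

lemma Lebesgue_norm_cmult_le:
  assumes p: "0 < p" and [measurable]: "f \<in> borel_measurable M"
  shows "Lebesgue_norm M p (\<lambda>x. c * f x) \<le> c * Lebesgue_norm M p f"
proof (cases "p = \<infinity>")
  case True
  have "AE x in M. c * f x \<le> c * esssup M f"
    using esssup_AE[of f M] by eventually_elim (rule mult_left_mono, auto)
  then have "esssup M (\<lambda>x. c * f x) \<le> c * esssup M f" by (intro esssup_I) auto
  then show ?thesis using True by (simp add: Lebesgue_norm_def)
next
  case False
  then have "0 < enn2real p" using p by (cases p) auto
  then show ?thesis using False by (simp add: Lebesgue_norm_def qnorm_cmult)
qed

lemma qnorm_essentially_bounded_factor:
  assumes "0 < \<sigma>" "0 < \<tau>" "0 < Q" and [measurable]: "X \<in> borel_measurable M" "Y \<in> borel_measurable M"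
  shows "qnorm M (Q / \<tau>) (\<lambda>x. epowr (X x) \<sigma> * epowr (Y x) \<tau>) \<le> epowr (esssup M X) \<sigma> * epowr (qnorm M Q Y) \<tau>"
proof -
  have "AE x in M. epowr (X x) \<sigma> * epowr (Y x) \<tau> \<le> epowr (esssup M X) \<sigma> * epowr (Y x) \<tau>"
    using esssup_AE[of X M] by eventually_elim (use assms in \<open>auto intro!: mult_right_mono epowr_mono\<close>)
  then have "qnorm M (Q / \<tau>) (\<lambda>x. epowr (X x) \<sigma> * epowr (Y x) \<tau>) \<le> qnorm M (Q / \<tau>) (\<lambda>x. epowr (esssup M X) \<sigma> * epowr (Y x) \<tau>)"
    using assms by (intro qnorm_mono) auto
  also have "\<dots> = epowr (esssup M X) \<sigma> * epowr (qnorm M Q Y) \<tau>"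
    using assms by (simp add: qnorm_cmult qnorm_epowr)
  finally show ?thesis .
qed

lemma qnorm_epowr_le_1:
  assumes "0 < P" "0 < \<rho>" "qnorm M (P * \<rho>) W \<le> 1"
  shows "qnorm M P (\<lambda>x. epowr (W x) \<rho>) \<le> 1"
  using assms epowr_mono[of \<rho> "qnorm M (P * \<rho>) W" 1] by (simp add: qnorm_epowr epowr_ennreal[of 1, simplified])

lemma esssup_epowr_0_le_1:
  assumes [measurable]: "W \<in> borel_measurable M" and "AE x in M. W x < \<infinity>"
  shows "esssup M (\<lambda>x. epowr (W x) 0) \<le> 1"
proof (intro esssup_I)
  show "AE x in M. epowr (W x) 0 \<le> 1"
    using assms(2) by eventually_elim (auto simp: epowr_def powr_def)
qed simp

text \<open>
  With \<open>\<rho>0 = r / p\<close> and \<open>\<rho>1 = r / q\<close>, powers of a function in the unit ball of \<open>L\<^sup>r\<close> lie in the unit balls of \<open>L\<^sup>p\<close>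
  and \<open>L\<^sup>q\<close>. If exactly one of \<open>p\<close>, \<open>q\<close> is infinite, its quotient is \<open>0\<close>, and if both are, both quotients are \<open>1\<close>.
  Collecting these four cases here keeps infinite exponents out of the later arguments.
\<close>

lemma interpolated_exponent:
  assumes \<theta>: "0 < \<theta>" "\<theta> < 1" and pq: "1 \<le> p" "1 \<le> q" 
    and r: "1 / r = ennreal (1 - \<theta>) / p + ennreal \<theta> / q"
  obtains \<rho>0 \<rho>1 :: real where "0 < r" "(1 - \<theta>) * \<rho>0 + \<theta> * \<rho>1 = 1"
    "\<And>W. W \<in> borel_measurable M \<Longrightarrow> AE x in M. W x < \<infinity> \<Longrightarrow> Lebesgue_norm M r W \<le> 1 \<Longrightarrow>
       Lebesgue_norm M p (\<lambda>x. epowr (W x) \<rho>0) \<le> 1 \<and> Lebesgue_norm M q (\<lambda>x. epowr (W x) \<rho>1) \<le> 1"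
    "\<And>X Y. X \<in> borel_measurable M \<Longrightarrow> Y \<in> borel_measurable M \<Longrightarrow> 
       Lebesgue_norm M r (\<lambda>x. epowr (X x) (1 - \<theta>) * epowr (Y x) \<theta>) \<le> 
       epowr (Lebesgue_norm M p X) (1 - \<theta>) * epowr (Lebesgue_norm M q Y) \<theta>"
proof -
  have r_eq: "r = ennreal (1 / y)" if "1 / r = ennreal y" "0 < y" for y
  proof (cases r)
    case (real r')
    then have "r' \<noteq> 0" using that by (auto simp: ennreal_divide_zero)
    then have "ennreal (1 / r') = ennreal y" using that real divide_ennreal[of 1 r'] by simp
    then have "1 / r' = y" using real that by (subst (asm) ennreal_inj) auto
    then show ?thesis using real by auto
  qed (use that in auto)
  show ?thesis
  proof (cases p)
    case p: (real P)
    then have P: "0 < P" "enn2real p = P" "p \<noteq> \<infinity>" using pq by auto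
    show ?thesis
    proof (cases q)
      case q: (real Q)
      then have Q: "0 < Q" "enn2real q = Q" "q \<noteq> \<infinity>" using pq by auto
      define y where "y = (1 - \<theta>) / P + \<theta> / Q"
      have y: "0 < y" using \<theta> P Q by (auto simp: y_def intro!: add_pos_pos)
      have "1 / r = ennreal y" 
        unfolding r p q y_def using \<theta> P Q by (simp add: divide_ennreal)
      then have R: "r = ennreal (1 / y)" using y by (rule r_eq)
      then have R': "enn2real r = 1 / y" "r \<noteq> \<infinity>" using y by auto
      show ?thesis
      proof (rule that[of "1 / (y * P)" "1 / (y * Q)"])
        show "0 < r" using R y by simp
        have "(1 - \<theta>) * (1 / (y * P)) + \<theta> * (1 / (y * Q)) = ((1 - \<theta>) / P + \<theta> / Q) / y" 
          by (simp add: add_divide_distrib mult.commute)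
        then show "(1 - \<theta>) * (1 / (y * P)) + \<theta> * (1 / (y * Q)) = 1" using y by (simp add: y_def[symmetric])
        show "Lebesgue_norm M p (\<lambda>x. epowr (W x) (1 / (y * P))) \<le> 1 \<and> Lebesgue_norm M q (\<lambda>x. epowr (W x) (1 / (y * Q))) \<le> 1"
          if "Lebesgue_norm M r W \<le> 1" for W
          using that P Q R' y by (auto simp: Lebesgue_norm_def intro!: qnorm_epowr_le_1)
        show "Lebesgue_norm M r (\<lambda>x. epowr (X x) (1 - \<theta>) * epowr (Y x) \<theta>) \<le> 
          epowr (Lebesgue_norm M p X) (1 - \<theta>) * epowr (Lebesgue_norm M q Y) \<theta>"
          if "X \<in> borel_measurable M" "Y \<in> borel_measurable M" for X Y
          using that P Q R' y by (auto simp: Lebesgue_norm_def y_def intro!: qnorm_Hoelder \<theta>)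
      qed
    next
      case q: top
      define y where "y = (1 - \<theta>) / P"
      have y: "0 < y" using \<theta> P by (auto simp: y_def)
      have "1 / r = ennreal y" 
        unfolding r p q y_def using \<theta> P by (simp add: divide_ennreal)
      then have R: "r = ennreal (1 / y)" using y by (rule r_eq)
      then have R': "enn2real r = P / (1 - \<theta>)" "r \<noteq> \<infinity>" using \<theta> P by (auto simp: y_def)
      show ?thesis
      proof (rule that[of "1 / (1 - \<theta>)" 0])
        show "0 < r" using R y by simp
        show "(1 - \<theta>) * (1 / (1 - \<theta>)) + \<theta> * 0 = 1" using \<theta> by simp
        show "Lebesgue_norm M p (\<lambda>x. epowr (W x) (1 / (1 - \<theta>))) \<le> 1 \<and> Lebesgue_norm M q (\<lambda>x. epowr (W x) 0) \<le> 1"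
          if "W \<in> borel_measurable M" "AE x in M. W x < \<infinity>" "Lebesgue_norm M r W \<le> 1" for W
          using that P q R' \<theta> by (auto simp: Lebesgue_norm_def intro!: qnorm_epowr_le_1 esssup_epowr_0_le_1)
        show "Lebesgue_norm M r (\<lambda>x. epowr (X x) (1 - \<theta>) * epowr (Y x) \<theta>) \<le> 
          epowr (Lebesgue_norm M p X) (1 - \<theta>) * epowr (Lebesgue_norm M q Y) \<theta>"
          if "X \<in> borel_measurable M" "Y \<in> borel_measurable M" for X Y
          using qnorm_essentially_bounded_factor[of \<theta> "1 - \<theta>" P Y M X] that P q R' \<theta> 
          by (simp add: Lebesgue_norm_def mult.commute)
      qed
    qed
  next
    case p: top
    show ?thesis
    proof (cases q)
      case q: (real Q)
      then have Q: "0 < Q" "enn2real q = Q" "q \<noteq> \<infinity>" using pq by auto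
      define y where "y = \<theta> / Q"
      have y: "0 < y" using \<theta> Q by (auto simp: y_def)
      have "1 / r = ennreal y" 
        unfolding r p q y_def using \<theta> Q by (simp add: divide_ennreal)
      then have R: "r = ennreal (1 / y)" using y by (rule r_eq)
      then have R': "enn2real r = Q / \<theta>" "r \<noteq> \<infinity>" using \<theta> Q by (auto simp: y_def)
      show ?thesis
      proof (rule that[of 0 "1 / \<theta>"])
        show "0 < r" using R y by simp
        show "(1 - \<theta>) * 0 + \<theta> * (1 / \<theta>) = 1" using \<theta> by simp
        show "Lebesgue_norm M p (\<lambda>x. epowr (W x) 0) \<le> 1 \<and> Lebesgue_norm M q (\<lambda>x. epowr (W x) (1 / \<theta>)) \<le> 1"
          if "W \<in> borel_measurable M" "AE x in M. W x < \<infinity>" "Lebesgue_norm M r W \<le> 1" for W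
          using that Q p R' \<theta> by (auto simp: Lebesgue_norm_def intro!: qnorm_epowr_le_1 esssup_epowr_0_le_1)
        show "Lebesgue_norm M r (\<lambda>x. epowr (X x) (1 - \<theta>) * epowr (Y x) \<theta>) \<le> 
          epowr (Lebesgue_norm M p X) (1 - \<theta>) * epowr (Lebesgue_norm M q Y) \<theta>"
          if "X \<in> borel_measurable M" "Y \<in> borel_measurable M" for X Y
          using qnorm_essentially_bounded_factor[of "1 - \<theta>" \<theta> Q X M Y] that Q p R' \<theta> 
          by (simp add: Lebesgue_norm_def)
      qed
    next
      case q: top
      have "1 / r = 0" unfolding r p q by simp
      then have R: "r = \<infinity>" by (cases r) (auto simp: divide_ennreal_def ennreal_inverse_eq_0_iff)
      show ?thesis
      proof (rule that[of 1 1])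
        show "0 < r" using R by simp
        show "(1 - \<theta>) * 1 + \<theta> * 1 = 1" by simp
        show "Lebesgue_norm M p (\<lambda>x. epowr (W x) 1) \<le> 1 \<and> Lebesgue_norm M q (\<lambda>x. epowr (W x) 1) \<le> 1"
          if "Lebesgue_norm M r W \<le> 1" for W
          using that p q R by (simp add: Lebesgue_norm_def)
        show "Lebesgue_norm M r (\<lambda>x. epowr (X x) (1 - \<theta>) * epowr (Y x) \<theta>) \<le> 
          epowr (Lebesgue_norm M p X) (1 - \<theta>) * epowr (Lebesgue_norm M q Y) \<theta>"
          if [measurable]: "X \<in> borel_measurable M" "Y \<in> borel_measurable M" for X Y
        proof -
          have "AE x in M. epowr (X x) (1 - \<theta>) * epowr (Y x) \<theta> \<le> epowr (esssup M X) (1 - \<theta>) * epowr (esssup M Y) \<theta>"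
            using esssup_AE[of X M] esssup_AE[of Y M] by eventually_elim (use \<theta> in \<open>auto intro!: mult_mono epowr_mono\<close>)
          then show ?thesis using p q R by (auto simp: Lebesgue_norm_def intro!: esssup_I)
        qed
      qed
    qed
  qed
qed

text \<open>
  The exponent \<open>g\<close> is chosen such that \<open>exp (- \<theta> * g) * \<alpha> = c' * \<omega> powr \<rho>0\<close> and
  \<open>exp ((1 - \<theta>) * g) * \<beta> = c' * \<omega> powr \<rho>1\<close> hold simultaneously; both are possible because the weighted geometric
  means of the right-hand sides and of \<open>\<alpha>\<close>, \<open>\<beta>\<close> agree. Truncating \<open>g\<close> at \<open>n\<close> harms only the first product, and
  truncating it at \<open>- n\<close> only the second, each by a small multiple of the original \<open>\<alpha>\<close> or \<open>\<beta>\<close>; rounding costs a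
  factor \<open>exp \<kappa>\<close>.
\<close>

lemma clamped_log_ratio:
  fixes \<alpha> \<beta> :: real
  assumes \<theta>: "0 < \<theta>" "\<theta> < 1" and \<rho>: "(1 - \<theta>) * \<rho>0 + \<theta> * \<rho>1 = 1"
    and \<alpha>: "0 < \<alpha>" and \<beta>: "0 < \<beta>" and c': "0 < c'" and \<kappa>: "0 < \<kappa>" and n: "0 < n"
    and \<omega>_eq: "\<omega> = \<alpha> powr (1 - \<theta>) * \<beta> powr \<theta> / c'"
    and g: "g = ln (\<alpha> / \<beta> * \<omega> powr (\<rho>1 - \<rho>0))"
    and gn: "gn = max (- n) (min n g)" and b_le: "gn - \<kappa> \<le> b" "b \<le> gn"
  shows "exp (- \<theta> * b) * \<alpha> \<le> exp \<kappa> * (c' * \<omega> powr \<rho>0 + exp (- (\<theta> * n)) * \<alpha>)"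
    and "exp ((1 - \<theta>) * b) * \<beta> \<le> exp \<kappa> * (c' * \<omega> powr \<rho>1 + exp (- ((1 - \<theta>) * n)) * \<beta>)"
proof -
  have \<omega>: "0 < \<omega>" using \<alpha> \<beta> c' by (simp add: \<omega>_eq)
  define l where "l = ln \<omega>"
  have g_eq: "g = ln \<alpha> - ln \<beta> + (\<rho>1 - \<rho>0) * l"
    using \<alpha> \<beta> \<omega> c' by (simp add: g ln_mult ln_div ln_powr l_def)
  have l_eq: "l = (1 - \<theta>) * ln \<alpha> + \<theta> * ln \<beta> - ln c'"
    using \<alpha> \<beta> c' by (simp add: l_def \<omega>_eq ln_mult ln_div ln_powr)
  have l_eq': "(1 - \<theta>) * ln \<alpha> + \<theta> * ln \<beta> = l + ln c'" using l_eq by simp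
  have lnD0: "- \<theta> * g + ln \<alpha> = ln c' + \<rho>0 * l"
  proof -
    have "- \<theta> * g + ln \<alpha> = ((1 - \<theta>) * ln \<alpha> + \<theta> * ln \<beta>) + \<theta> * \<rho>0 * l - (\<theta> * \<rho>1) * l"
      unfolding g_eq by (simp add: algebra_simps)
    also have "\<theta> * \<rho>1 = 1 - (1 - \<theta>) * \<rho>0" using \<rho> by linarith
    finally show ?thesis unfolding l_eq' by (simp add: algebra_simps)
  qed
  have lnD1: "(1 - \<theta>) * g + ln \<beta> = ln c' + \<rho>1 * l"
  proof -
    have "(1 - \<theta>) * g + ln \<beta> = ((1 - \<theta>) * ln \<alpha> + \<theta> * ln \<beta>) + (1 - \<theta>) * \<rho>1 * l - ((1 - \<theta>) * \<rho>0) * l"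
      unfolding g_eq by (simp add: algebra_simps)
    also have "(1 - \<theta>) * \<rho>0 = 1 - \<theta> * \<rho>1" using \<rho> by linarith
    finally show ?thesis unfolding l_eq' by (simp add: algebra_simps)
  qed
  have D0: "exp (- \<theta> * g) * \<alpha> = c' * \<omega> powr \<rho>0"
  proof -
    have "exp (- \<theta> * g) * \<alpha> = exp (- \<theta> * g + ln \<alpha>)" using \<alpha> by (simp only: exp_add exp_ln)
    also have "\<dots> = c' * \<omega> powr \<rho>0" unfolding lnD0 using c' \<omega> by (simp add: exp_add powr_def l_def)
    finally show ?thesis .
  qed
  have D1: "exp ((1 - \<theta>) * g) * \<beta> = c' * \<omega> powr \<rho>1"
  proof -
    have "exp ((1 - \<theta>) * g) * \<beta> = exp ((1 - \<theta>) * g + ln \<beta>)" using \<beta> by (simp only: exp_add exp_ln)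
    also have "\<dots> = c' * \<omega> powr \<rho>1" unfolding lnD1 using c' \<omega> by (simp add: exp_add powr_def l_def)
    finally show ?thesis .
  qed
  \<comment> \<open>Rounding down loses a factor here, whereas it only helps in the second estimate.\<close>
  have e0: "exp (- \<theta> * b) \<le> exp \<kappa> * (exp (- \<theta> * g) + exp (- (\<theta> * n)))"
  proof -
    have "\<theta> * (gn - \<kappa>) \<le> \<theta> * b" using b_le \<theta> by (intro mult_left_mono) auto
    moreover have "\<theta> * \<kappa> \<le> 1 * \<kappa>" using \<theta> \<kappa> by (intro mult_right_mono) auto
    ultimately have "- \<theta> * b \<le> \<kappa> + (- \<theta> * gn)" by (simp add: algebra_simps)
    then have "exp (- \<theta> * b) \<le> exp \<kappa> * exp (- \<theta> * gn)" by (metis exp_add exp_le_cancel_iff)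
    also have "exp (- \<theta> * gn) \<le> exp (- \<theta> * g) + exp (- (\<theta> * n))"
    proof (cases "g \<le> n")
      case True
      then have "\<theta> * g \<le> \<theta> * gn" using \<theta> by (intro mult_left_mono) (auto simp: gn)
      then have "exp (- \<theta> * gn) \<le> exp (- \<theta> * g)" by simp
      then show ?thesis by (rule order_trans) simp
    next
      case False
      then have "gn = n" using n by (auto simp: gn)
      then show ?thesis by simp
    qed
    finally show ?thesis by simp
  qed
  have e1: "exp ((1 - \<theta>) * b) \<le> exp \<kappa> * (exp ((1 - \<theta>) * g) + exp (- ((1 - \<theta>) * n)))"
  proof -
    have "exp ((1 - \<theta>) * b) \<le> exp ((1 - \<theta>) * gn)" using b_le \<theta> by (simp add: mult_left_mono)
    also have "\<dots> \<le> exp ((1 - \<theta>) * g) + exp (- ((1 - \<theta>) * n))"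
    proof (cases "- n \<le> g")
      case True
      then have "(1 - \<theta>) * gn \<le> (1 - \<theta>) * g" using \<theta> n by (intro mult_left_mono) (auto simp: gn)
      then have "exp ((1 - \<theta>) * gn) \<le> exp ((1 - \<theta>) * g)" by simp
      then show ?thesis by (rule order_trans) simp
    next
      case False
      then have "gn = - n" using n by (auto simp: gn)
      then show ?thesis by simp
    qed
    also have "\<dots> \<le> exp \<kappa> * (exp ((1 - \<theta>) * g) + exp (- ((1 - \<theta>) * n)))"
      using \<kappa> mult_right_mono[of 1 "exp \<kappa>" "exp ((1 - \<theta>) * g) + exp (- ((1 - \<theta>) * n))"] by (simp add: add_nonneg_nonneg)
    finally show ?thesis .
  qed
  have "exp (- \<theta> * b) * \<alpha> \<le> exp \<kappa> * (exp (- \<theta> * g) + exp (- (\<theta> * n))) * \<alpha>"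
    using \<alpha> by (intro mult_right_mono e0) auto
  also have "\<dots> = exp \<kappa> * (c' * \<omega> powr \<rho>0 + exp (- (\<theta> * n)) * \<alpha>)"
    unfolding D0[symmetric] by (simp add: algebra_simps)
  finally show "exp (- \<theta> * b) * \<alpha> \<le> \<dots>" .
  have "exp ((1 - \<theta>) * b) * \<beta> \<le> exp \<kappa> * (exp ((1 - \<theta>) * g) + exp (- ((1 - \<theta>) * n))) * \<beta>"
    using \<beta> by (intro mult_right_mono e1) auto
  also have "\<dots> = exp \<kappa> * (c' * \<omega> powr \<rho>1 + exp (- ((1 - \<theta>) * n)) * \<beta>)"
    unfolding D1[symmetric] by (simp add: algebra_simps)
  finally show "exp ((1 - \<theta>) * b) * \<beta> \<le> \<dots>" .
qed

text \<open>
  The classical family \<open>f * |f|\<^sup>\<dots> * w\<^sup>\<dots> * v\<^sup>\<dots>\<close> need not consist of simple functions. It has the form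
  \<open>f * exp (g * (z - \<theta>))\<close> with a real function \<open>g\<close>, and truncating and rounding \<open>g\<close> gives a simple function \<open>b\<close>.
  The truncation error is a small multiple of the norms of \<open>f\<close> in the two endpoint spaces, which is why
  both are assumed finite, and adding it to the main term uses the triangle inequality, that is
  \<open>p, q \<ge> 1\<close>.
\<close>

lemma balancing_exponent:
  fixes f :: "'a \<Rightarrow> complex"
  assumes \<theta>: "0 < \<theta>" "\<theta> < 1" and pq: "1 \<le> p" "1 \<le> q" 
    and r: "1 / r = ennreal (1 - \<theta>) / p + ennreal \<theta> / q"
    and w: "weight M w" and v: "weight M v"
    and u: "\<And>x. x \<in> space M \<Longrightarrow> u x = epowr (w x) (1 - \<theta>) * epowr (v x) \<theta>"
    and f [measurable]: "f \<in> borel_measurable M"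
    and fp: "Lp_norm M p w f < \<infinity>" and fq: "Lp_norm M q v f < \<infinity>" and \<eta>: "0 < \<eta>"
  shows "Lp_norm M r u f < \<infinity> \<and> (\<exists>b :: 'a \<Rightarrow> real. simple_function M b \<and>
     Lp_norm M p w (\<lambda>x. f x * exp (- \<theta> * b x)) \<le> Lp_norm M r u f + ennreal \<eta> \<and>
     Lp_norm M q v (\<lambda>x. f x * exp ((1 - \<theta>) * b x)) \<le> Lp_norm M r u f + ennreal \<eta>)"
proof -
  have [measurable]: "w \<in> borel_measurable M" "v \<in> borel_measurable M"
    and wv: "AE x in M. 0 < w x \<and> w x < \<infinity> \<and> 0 < v x \<and> v x < \<infinity>"
    using w v unfolding weight_def by (auto elim!: eventually_elim2)
  define A where "A x = ennreal (norm (f x)) * w x" for x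
  define B where "B x = ennreal (norm (f x)) * v x" for x
  have [measurable]: "A \<in> borel_measurable M" "B \<in> borel_measurable M"
    by (auto simp: A_def[abs_def] B_def[abs_def])
  define U where "U x = epowr (A x) (1 - \<theta>) * epowr (B x) \<theta>" for x
  have [measurable]: "U \<in> borel_measurable M" by (auto simp: U_def[abs_def])
  have U: "U x = ennreal (norm (f x)) * u x" if "x \<in> space M" for x
  proof -
    have "ennreal (norm (f x)) = epowr (ennreal (norm (f x))) ((1 - \<theta>) + \<theta>)" by simp
    also have "\<dots> = epowr (ennreal (norm (f x))) (1 - \<theta>) * epowr (ennreal (norm (f x))) \<theta>"
      by (rule epowr_add)
    finally show ?thesis unfolding U_def A_def B_def u[OF that] epowr_mult by (metis mult.assoc mult.left_commute)
  qed
  have mU: "(\<lambda>x. ennreal (norm (f x)) * u x) \<in> borel_measurable M"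
    by (subst measurable_cong[where g = U]) (auto simp: U)
  have fr: "Lp_norm M r u f = Lebesgue_norm M r U"
    unfolding Lp_norm_eq Lebesgue_norm_def qnorm_def using U mU
    by (auto intro!: esssup_AE_cong nn_integral_cong arg_cong2[where f = epowr] AE_I2)
  have fpA: "Lp_norm M p w f = Lebesgue_norm M p A" "Lp_norm M q v f = Lebesgue_norm M q B"
    by (simp_all add: Lp_norm_eq A_def[abs_def] B_def[abs_def])
  obtain \<rho>0 \<rho>1 where r0: "0 < r" and \<rho>: "(1 - \<theta>) * \<rho>0 + \<theta> * \<rho>1 = 1"
    and \<rho>_norm: "\<And>W. W \<in> borel_measurable M \<Longrightarrow> AE x in M. W x < \<infinity> \<Longrightarrow> Lebesgue_norm M r W \<le> 1 \<Longrightarrow>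
       Lebesgue_norm M p (\<lambda>x. epowr (W x) \<rho>0) \<le> 1 \<and> Lebesgue_norm M q (\<lambda>x. epowr (W x) \<rho>1) \<le> 1"
    and hoelder: "\<And>X Y. X \<in> borel_measurable M \<Longrightarrow> Y \<in> borel_measurable M \<Longrightarrow> 
       Lebesgue_norm M r (\<lambda>x. epowr (X x) (1 - \<theta>) * epowr (Y x) \<theta>) \<le> 
       epowr (Lebesgue_norm M p X) (1 - \<theta>) * epowr (Lebesgue_norm M q Y) \<theta>"
    using interpolated_exponent[OF \<theta> pq r, where M = M] by blast
  have "Lebesgue_norm M r U \<le> epowr (Lebesgue_norm M p A) (1 - \<theta>) * epowr (Lebesgue_norm M q B) \<theta>"
    unfolding U_def[abs_def] by (rule hoelder) auto
  also have "\<dots> < \<infinity>"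
    using fp fq unfolding fpA 
    by (auto simp: less_top[symmetric] epowr_eq_top_iff ennreal_mult_eq_top_iff)
  finally have fin: "Lp_norm M r u f < \<infinity>" unfolding fr .
  then obtain c where c: "Lp_norm M r u f = ennreal c" "0 \<le> c" by (auto simp: less_top_ennreal)
  obtain cp where cp: "Lp_norm M p w f = ennreal cp" "0 \<le> cp" using fp by (auto simp: less_top_ennreal)
  obtain cq where cq: "Lp_norm M q v f = ennreal cq" "0 \<le> cq" using fq by (auto simp: less_top_ennreal)
  \<comment> \<open>The summand keeps \<open>c'\<close> positive even if \<open>f\<close> vanishes almost everywhere.\<close>
  define c' where "c' = c + \<eta> / 2"
  have c': "0 < c'" using c \<eta> by (simp add: c'_def)
  define W where "W x = ennreal (1 / c') * U x" for x
  have [measurable]: "W \<in> borel_measurable M" by (simp add: W_def[abs_def])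
  have W_fin: "AE x in M. W x < \<infinity>"
    using wv by eventually_elim 
      (auto simp: W_def U_def A_def B_def ennreal_mult_less_top less_top[symmetric] epowr_eq_top_iff ennreal_mult_eq_top_iff)
  have "Lebesgue_norm M r W \<le> ennreal (1 / c') * ennreal c"
    using Lebesgue_norm_cmult_le[OF r0, of U M "ennreal (1 / c')"] by (simp add: W_def[abs_def] c(1)[symmetric] fr)
  also have "\<dots> \<le> 1" using c c' \<eta> by (simp add: c'_def flip: ennreal_mult)
  finally have W_le: "Lebesgue_norm M p (\<lambda>x. epowr (W x) \<rho>0) \<le> 1" "Lebesgue_norm M q (\<lambda>x. epowr (W x) \<rho>1) \<le> 1"
    using \<rho>_norm[OF _ W_fin] by auto
  \<comment> \<open>\<open>\<kappa>\<close> bounds both the rounding error and the contribution of the truncation.\<close>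
  have "((\<lambda>\<kappa>. exp \<kappa> * (c' + \<kappa>)) \<longlongrightarrow> exp 0 * (c' + 0)) (at_right 0)"
    by (intro tendsto_intros)
  then have "\<forall>\<^sub>F \<kappa> in at_right 0. exp \<kappa> * (c' + \<kappa>) < c + \<eta>"
    by (rule order_tendstoD) (use \<eta> in \<open>simp add: c'_def\<close>)
  moreover have "\<forall>\<^sub>F \<kappa> :: real in at_right 0. 0 < \<kappa>" by (rule eventually_at_right_less)
  ultimately obtain \<kappa> where \<kappa>: "0 < \<kappa>" "exp \<kappa> * (c' + \<kappa>) < c + \<eta>"
    using eventually_happens'[OF trivial_limit_at_right_real eventually_conj] by blast
  have "((\<lambda>n :: real. exp (- (t * n)) * d) \<longlongrightarrow> 0) at_top" if "0 < t" for t d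
    using that by real_asymp
  then have "\<forall>\<^sub>F n in at_top. exp (- (\<theta> * n)) * cp < \<kappa>" "\<forall>\<^sub>F n in at_top. exp (- ((1 - \<theta>) * n)) * cq < \<kappa>"
    using \<theta> \<kappa> order_tendstoD(2) by (metis diff_gt_0_iff_gt)+
  then obtain n where n: "exp (- (\<theta> * n)) * cp < \<kappa>" "exp (- ((1 - \<theta>) * n)) * cq < \<kappa>" "0 < n"
    using eventually_happens'[OF trivial_limit_at_top_linorder 
        eventually_conj[OF eventually_conj eventually_gt_at_top[of 0]]] by blast
  define \<alpha> where "\<alpha> x = norm (f x) * enn2real (w x)" for x
  define \<beta> where "\<beta> x = norm (f x) * enn2real (v x)" for x
  define \<omega> where "\<omega> x = \<alpha> x powr (1 - \<theta>) * \<beta> x powr \<theta> / c'" for x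
  define g where "g x = ln (\<alpha> x / \<beta> x * \<omega> x powr (\<rho>1 - \<rho>0))" for x
  define gn where "gn x = max (- n) (min n (g x))" for x
  define b where "b x = \<kappa> * of_int \<lfloor>gn x / \<kappa>\<rfloor>" for x
  have [measurable]: "b \<in> borel_measurable M"
    unfolding b_def[abs_def] gn_def g_def \<omega>_def \<alpha>_def \<beta>_def by measurable
  have b_le: "b x \<le> gn x" "gn x - \<kappa> \<le> b x" for x
  proof -
    have "\<kappa> * of_int \<lfloor>gn x / \<kappa>\<rfloor> \<le> \<kappa> * (gn x / \<kappa>)" "\<kappa> * (gn x / \<kappa> - 1) \<le> \<kappa> * of_int \<lfloor>gn x / \<kappa>\<rfloor>"
      using \<kappa>(1) by (intro mult_left_mono; linarith)+
    then show "b x \<le> gn x" "gn x - \<kappa> \<le> b x" using \<kappa>(1) by (simp_all add: b_def right_diff_distrib)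
  qed
  have "simple_function M b"
  proof (rule simple_function_borel_measurable)
    have "b ` space M \<subseteq> (\<lambda>i. \<kappa> * of_int i) ` {\<lfloor>- n / \<kappa>\<rfloor>..\<lfloor>n / \<kappa>\<rfloor>}"
    proof
      fix y assume "y \<in> b ` space M"
      then obtain x where x: "y = b x" by auto
      have "- n \<le> gn x" "gn x \<le> n" using n by (auto simp: gn_def)
      then have "\<lfloor>- n / \<kappa>\<rfloor> \<le> \<lfloor>gn x / \<kappa>\<rfloor>" "\<lfloor>gn x / \<kappa>\<rfloor> \<le> \<lfloor>n / \<kappa>\<rfloor>"
        using \<kappa> by (intro floor_mono divide_right_mono; simp)+
      then show "y \<in> (\<lambda>i. \<kappa> * of_int i) ` {\<lfloor>- n / \<kappa>\<rfloor>..\<lfloor>n / \<kappa>\<rfloor>}" by (auto simp: x b_def)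
    qed
    then show "finite (b ` space M)" by (rule finite_subset) auto
  qed simp
  have key: "ennreal (norm (f x * exp (- \<theta> * b x))) * w x \<le> ennreal (exp \<kappa>) * (ennreal c' * epowr (W x) \<rho>0 + ennreal (exp (- (\<theta> * n))) * A x) \<and>
             ennreal (norm (f x * exp ((1 - \<theta>) * b x))) * v x \<le> ennreal (exp \<kappa>) * (ennreal c' * epowr (W x) \<rho>1 + ennreal (exp (- ((1 - \<theta>) * n))) * B x)"
    if x: "0 < w x \<and> w x < \<infinity> \<and> 0 < v x \<and> v x < \<infinity>" for x
  proof (cases "f x = 0")
    case False
    obtain w' v' where w': "w x = ennreal w'" "0 < w'" and v': "v x = ennreal v'" "0 < v'"
      using x by (metis ennreal_cases ennreal_less_zero_iff less_irrefl infinity_ennreal_def)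
    have \<alpha>: "\<alpha> x = norm (f x) * w'" "0 < \<alpha> x" and \<beta>: "\<beta> x = norm (f x) * v'" "0 < \<beta> x"
      using w' v' False by (auto simp: \<alpha>_def \<beta>_def)
    have A: "A x = ennreal (\<alpha> x)" and B: "B x = ennreal (\<beta> x)"
      using w' v' by (simp_all add: A_def B_def \<alpha> \<beta> ennreal_mult)
    have \<omega>: "0 < \<omega> x" unfolding \<omega>_def using \<alpha>(2) \<beta>(2) c' by (intro divide_pos_pos mult_pos_pos) auto
    have Wx: "W x = ennreal (\<omega> x)"
      using \<alpha>(2) \<beta>(2) c' by (simp add: W_def U_def A B \<omega>_def epowr_ennreal flip: ennreal_mult)
    have e: "exp (- \<theta> * b x) * \<alpha> x \<le> exp \<kappa> * (c' * \<omega> x powr \<rho>0 + exp (- (\<theta> * n)) * \<alpha> x)"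
      "exp ((1 - \<theta>) * b x) * \<beta> x \<le> exp \<kappa> * (c' * \<omega> x powr \<rho>1 + exp (- ((1 - \<theta>) * n)) * \<beta> x)"
      using clamped_log_ratio[OF \<theta> \<rho> \<alpha>(2) \<beta>(2) c' \<kappa>(1) n(3) \<omega>_def g_def gn_def b_le(2,1)] by auto
    have "ennreal (norm (f x * exp (- \<theta> * b x))) * w x = ennreal (exp (- \<theta> * b x) * \<alpha> x)"
      using w' by (simp add: norm_mult \<alpha>(1) mult_ac flip: ennreal_mult)
    also have "\<dots> \<le> ennreal (exp \<kappa> * (c' * \<omega> x powr \<rho>0 + exp (- (\<theta> * n)) * \<alpha> x))"
      by (intro ennreal_leI e)
    also have "\<dots> = ennreal (exp \<kappa>) * (ennreal c' * epowr (W x) \<rho>0 + ennreal (exp (- (\<theta> * n))) * A x)"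
      using c' \<omega> \<alpha>(2) by (simp add: A Wx epowr_ennreal ennreal_mult ennreal_plus)
    finally have 1: "ennreal (norm (f x * exp (- \<theta> * b x))) * w x \<le> \<dots>" .
    have "ennreal (norm (f x * exp ((1 - \<theta>) * b x))) * v x = ennreal (exp ((1 - \<theta>) * b x) * \<beta> x)"
      using v' by (simp add: norm_mult \<beta>(1) mult_ac flip: ennreal_mult)
    also have "\<dots> \<le> ennreal (exp \<kappa> * (c' * \<omega> x powr \<rho>1 + exp (- ((1 - \<theta>) * n)) * \<beta> x))"
      by (intro ennreal_leI e)
    also have "\<dots> = ennreal (exp \<kappa>) * (ennreal c' * epowr (W x) \<rho>1 + ennreal (exp (- ((1 - \<theta>) * n))) * B x)"
      using c' \<omega> \<beta>(2) by (simp add: B Wx epowr_ennreal ennreal_mult ennreal_plus)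
    finally show ?thesis using 1 by blast
  qed simp
  have final: "Lebesgue_norm M p' X \<le> Lp_norm M r u f + ennreal \<eta>"
    if p': "1 \<le> p'" and [measurable]: "X \<in> borel_measurable M" "Y \<in> borel_measurable M" "Z \<in> borel_measurable M"
      and X: "AE x in M. X x \<le> ennreal (exp \<kappa>) * (ennreal c' * Y x + ennreal t * Z x)"
      and Y: "Lebesgue_norm M p' Y \<le> 1" and Z: "Lebesgue_norm M p' Z = ennreal d" "0 \<le> d" "0 < t" "t * d < \<kappa>"
    for p' X Y Z t d
  proof -
    have p0: "0 < p'" using p' by (metis ennreal_zero_less_one order_less_le_trans)
    have "Lebesgue_norm M p' X \<le> Lebesgue_norm M p' (\<lambda>x. ennreal (exp \<kappa>) * (ennreal c' * Y x + ennreal t * Z x))"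
      by (intro Lebesgue_norm_mono p' X) simp
    also have "\<dots> \<le> ennreal (exp \<kappa>) * Lebesgue_norm M p' (\<lambda>x. ennreal c' * Y x + ennreal t * Z x)"
      by (intro Lebesgue_norm_cmult_le p0) simp
    also have "\<dots> \<le> ennreal (exp \<kappa>) * (Lebesgue_norm M p' (\<lambda>x. ennreal c' * Y x) + Lebesgue_norm M p' (\<lambda>x. ennreal t * Z x))"
      by (intro mult_left_mono Lebesgue_norm_triangle p') simp_all
    also have "\<dots> \<le> ennreal (exp \<kappa>) * (ennreal c' * Lebesgue_norm M p' Y + ennreal t * Lebesgue_norm M p' Z)"
      by (intro mult_left_mono add_mono Lebesgue_norm_cmult_le p0) simp_all
    also have "\<dots> \<le> ennreal (exp \<kappa>) * (ennreal c' * 1 + ennreal t * ennreal d)"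
      unfolding Z(1) by (intro mult_left_mono add_mono Y) simp_all
    also have "\<dots> = ennreal (exp \<kappa> * (c' + t * d))"
      using c' Z by (simp add: ennreal_mult ennreal_plus)
    also have "\<dots> \<le> ennreal (c + \<eta>)"
    proof (rule ennreal_leI)
      have "exp \<kappa> * (c' + t * d) \<le> exp \<kappa> * (c' + \<kappa>)" using Z by (intro mult_left_mono) auto
      then show "exp \<kappa> * (c' + t * d) \<le> c + \<eta>" using \<kappa> by linarith
    qed
    also have "\<dots> = Lp_norm M r u f + ennreal \<eta>" using c \<eta> by (simp add: ennreal_plus)
    finally show ?thesis .
  qed
  have "Lp_norm M p w (\<lambda>x. f x * exp (- \<theta> * b x)) \<le> Lp_norm M r u f + ennreal \<eta>"
    unfolding Lp_norm_eq[of M p]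
  proof (rule final[where Y = "\<lambda>x. epowr (W x) \<rho>0" and Z = A])
    show "AE x in M. ennreal (norm (f x * exp (- \<theta> * b x))) * w x \<le> ennreal (exp \<kappa>) * (ennreal c' * epowr (W x) \<rho>0 + ennreal (exp (- (\<theta> * n))) * A x)"
      using wv by eventually_elim (use key in blast)
  qed (use pq W_le cp n in \<open>auto simp: fpA[symmetric]\<close>)
  moreover have "Lp_norm M q v (\<lambda>x. f x * exp ((1 - \<theta>) * b x)) \<le> Lp_norm M r u f + ennreal \<eta>"
    unfolding Lp_norm_eq[of M q]
  proof (rule final[where Y = "\<lambda>x. epowr (W x) \<rho>1" and Z = B])
    show "AE x in M. ennreal (norm (f x * exp ((1 - \<theta>) * b x))) * v x \<le> ennreal (exp \<kappa>) * (ennreal c' * epowr (W x) \<rho>1 + ennreal (exp (- ((1 - \<theta>) * n))) * B x)"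
      using wv by eventually_elim (use key in blast)
  qed (use pq W_le cq n in \<open>auto simp: fpA[symmetric]\<close>)
  ultimately show ?thesis using fin \<open>simple_function M b\<close> by blast
qed

section \<open>Simple functions and multilinear operators\<close>

lemma strip_bounded_const: "strip_bounded (\<lambda>z. c)"
  by (auto simp: strip_bounded_def image_constant_conv)

lemma strip_bounded_add: 
  assumes "strip_bounded g" "strip_bounded h"
  shows "strip_bounded (\<lambda>z. g z + h z)"
proof -
  have "bounded ((\<lambda>z. g z + h z) ` S)" if "bounded (g ` S)" "bounded (h ` S)" for S
    using bounded_plus_comp[OF that] .
  then show ?thesis using assms by (auto simp: strip_bounded_def intro!: holomorphic_intros)
qed

lemma strip_bounded_mult: 
  assumes "strip_bounded g" "strip_bounded h"
  shows "strip_bounded (\<lambda>z. g z * h z)"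
proof -
  have "bounded ((\<lambda>z. g z * h z) ` S)" if gh: "bounded (g ` S)" "bounded (h ` S)" for S
  proof -
    obtain a b where "\<And>z. z \<in> S \<Longrightarrow> norm (g z) \<le> a" "\<And>z. z \<in> S \<Longrightarrow> norm (h z) \<le> b" "0 < a"
      using gh unfolding bounded_pos by auto
    then show ?thesis
      unfolding bounded_iff by (intro exI[of _ "a * b"]) (auto simp: norm_mult intro!: mult_mono)
  qed
  then show ?thesis using assms by (auto simp: strip_bounded_def intro!: holomorphic_intros)
qed

lemma strip_bounded_sum: 
  assumes "\<And>i. i \<in> I \<Longrightarrow> strip_bounded (h i)"
  shows "strip_bounded (\<lambda>z. \<Sum>i\<in>I. h i z)"
  using assms by (induction I rule: infinite_finite_induct) (auto intro: strip_bounded_const strip_bounded_add)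

lemma strip_bounded_exp: "strip_bounded (\<lambda>z. exp (of_real \<beta> * (z - of_real \<theta>)))"
  unfolding strip_bounded_def
proof
  show "bounded ((\<lambda>z. exp (of_real \<beta> * (z - of_real \<theta>))) ` {z. 0 \<le> Re z \<and> Re z \<le> 1})"
    unfolding bounded_iff
  proof (intro exI ballI)
    fix y assume "y \<in> (\<lambda>z. exp (complex_of_real \<beta> * (z - complex_of_real \<theta>))) ` {z. 0 \<le> Re z \<and> Re z \<le> 1}"
    then obtain z where z: "y = exp (complex_of_real \<beta> * (z - complex_of_real \<theta>))" "0 \<le> Re z" "Re z \<le> 1" by auto
    have "\<beta> * (Re z - \<theta>) \<le> \<bar>\<beta>\<bar> * \<bar>Re z - \<theta>\<bar>" by (metis abs_ge_self abs_mult)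
    also have "\<dots> \<le> \<bar>\<beta>\<bar> * (1 + \<bar>\<theta>\<bar>)" using z by (intro mult_left_mono) auto
    finally show "norm y \<le> exp (\<bar>\<beta>\<bar> * (1 + \<bar>\<theta>\<bar>))" by (simp add: z norm_exp_eq_Re)
  qed
qed (intro holomorphic_intros)

lemma simple_fnsI:
  assumes I: "finite I" and E: "\<And>i. i \<in> I \<Longrightarrow> E i \<in> sets M \<and> emeasure M (E i) < \<infinity>"
  shows "(\<lambda>x. \<Sum>i\<in>I. c i * indicator (E i) x) \<in> simple_fns M"
proof -
  obtain h where h: "bij_betw h {0..<card I} I" using ex_bij_betw_nat_finite[OF I] by blast
  have "(\<Sum>i\<in>I. c i * indicator (E i) x) = (\<Sum>k<card I. c (h k) * indicator (E (h k)) x)" for x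
    using sum.reindex_bij_betw[OF h, of "\<lambda>i. c i * indicator (E i) x"] by (simp add: atLeast0LessThan)
  moreover have "\<forall>k<card I. E (h k) \<in> sets M \<and> emeasure M (E (h k)) < \<infinity>"
    using h E by (auto dest: bij_betwE)
  ultimately show ?thesis unfolding simple_fns_def mem_Collect_eq
    by (intro exI[of _ "card I"] exI[of _ "\<lambda>k. c (h k)"] exI[of _ "\<lambda>k. E (h k)"]) auto
qed

lemma simple_fnsE:
  assumes "f \<in> simple_fns M"
  obtains n :: nat and c E where "\<And>k. k < n \<Longrightarrow> E k \<in> sets M \<and> emeasure M (E k) < \<infinity>" 
    "f = (\<lambda>x. \<Sum>k<n. c k * indicator (E k) x)"
  using assms unfolding simple_fns_def by blast

lemma simple_fns_measurable: 
  assumes "f \<in> simple_fns M" shows "f \<in> borel_measurable M"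
proof -
  obtain n :: nat and c E where f: "\<And>k. k < n \<Longrightarrow> E k \<in> sets M \<and> emeasure M (E k) < \<infinity>" 
    "f = (\<lambda>x. \<Sum>k<n. c k * indicator (E k) x)" using assms(1) by (rule simple_fnsE) blast
  show ?thesis unfolding f(2)
    by (intro borel_measurable_sum borel_measurable_times borel_measurable_const borel_measurable_indicator)
       (use f(1) in auto)
qed

lemma simple_fns_outside: "f \<in> simple_fns M \<Longrightarrow> x \<notin> space M \<Longrightarrow> f x = 0"
  by (elim simple_fnsE) (auto intro!: sum.neutral simp: indicator_def dest: sets.sets_into_space)

lemma simple_fns_zero: "(\<lambda>x. 0) \<in> simple_fns M"
  using simple_fnsI[of "{}"] by simp

lemma simple_fns_add:
  assumes "f \<in> simple_fns M" "g \<in> simple_fns M"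
  shows "(\<lambda>x. f x + g x) \<in> simple_fns M"
proof -
  obtain n :: nat and c E where f: "\<And>k. k < n \<Longrightarrow> E k \<in> sets M \<and> emeasure M (E k) < \<infinity>" 
    "f = (\<lambda>x. \<Sum>k<n. c k * indicator (E k) x)" using assms(1) by (rule simple_fnsE) blast
  obtain m :: nat and d F where g: "\<And>k. k < m \<Longrightarrow> F k \<in> sets M \<and> emeasure M (F k) < \<infinity>" 
    "g = (\<lambda>x. \<Sum>k<m. d k * indicator (F k) x)" using assms(2) by (rule simple_fnsE) blast
  have "(\<lambda>x. \<Sum>i\<in>{..<n} <+> {..<m}. case_sum c d i * indicator (case_sum E F i) x) \<in> simple_fns M"
    by (rule simple_fnsI) (use f(1) g(1) in auto)
  then show ?thesis
    by (simp only: f(2) g(2) sum.Plus[OF finite_lessThan finite_lessThan] o_def sum.case)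
qed

lemma simple_fns_cmult:
  assumes "f \<in> simple_fns M"
  shows "(\<lambda>x. a * f x) \<in> simple_fns M"
proof -
  obtain n :: nat and c E where f: "\<And>k. k < n \<Longrightarrow> E k \<in> sets M \<and> emeasure M (E k) < \<infinity>" 
    "f = (\<lambda>x. \<Sum>k<n. c k * indicator (E k) x)" using assms(1) by (rule simple_fnsE) blast
  have "(\<lambda>x. \<Sum>i<n. (a * c i) * indicator (E i) x) \<in> simple_fns M"
    by (rule simple_fnsI) (use f(1) in auto)
  then show ?thesis by (simp only: f(2) sum_distrib_left mult.assoc)
qed

lemma simple_fns_restrict:
  assumes "f \<in> simple_fns M" and A: "A \<in> sets M"
  shows "(\<lambda>x. f x * indicator A x) \<in> simple_fns M"
proof -
  obtain n :: nat and c E where f: "\<And>k. k < n \<Longrightarrow> E k \<in> sets M \<and> emeasure M (E k) < \<infinity>" 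
    "f = (\<lambda>x. \<Sum>k<n. c k * indicator (E k) x)" using assms(1) by (rule simple_fnsE) blast
  have "emeasure M (E k \<inter> A) < \<infinity>" if "k < n" for k
    using emeasure_mono[of "E k \<inter> A" "E k" M] f(1)[OF that] by (auto intro: le_less_trans)
  then have "(\<lambda>x. \<Sum>k<n. c k * indicator (E k \<inter> A) x) \<in> simple_fns M"
    using A by (intro simple_fnsI) (auto dest: f(1))
  then show ?thesis by (simp only: f(2) sum_distrib_right indicator_inter_arith mult.assoc)
qed

lemma simple_fns_sum:
  assumes "\<And>i. i \<in> I \<Longrightarrow> g i \<in> simple_fns M"
  shows "(\<lambda>x. \<Sum>i\<in>I. a i * g i x) \<in> simple_fns M"
  using assms
proof (induction I rule: infinite_finite_induct)
  case (insert i I)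
  have "(\<lambda>x. a i * g i x + (\<Sum>i\<in>I. a i * g i x)) \<in> simple_fns M"
    using insert by (intro simple_fns_add simple_fns_cmult) auto
  then show ?case using insert.hyps by simp
qed (simp_all add: simple_fns_zero)

definition level :: "'a measure \<Rightarrow> ('a \<Rightarrow> real) \<Rightarrow> real \<Rightarrow> 'a set" where
  "level M b \<beta> = {x \<in> space M. b x = \<beta>}"

text \<open>
  As \<open>b\<close> has finitely many values, the twisted function is a combination of fixed simple functions with
  coefficients that are exponentials in \<open>\<zeta>\<close>.
\<close>

lemma simple_fns_exp_decomp:
  assumes f: "f \<in> simple_fns M" and b: "simple_function M b"
  shows "(\<lambda>x. f x * exp (of_real (b x) * \<zeta>)) = 
     (\<lambda>x. \<Sum>\<beta>\<in>b ` space M. exp (of_real \<beta> * \<zeta>) * (f x * indicator (level M b \<beta>) x))"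
proof
  fix x
  show "f x * exp (of_real (b x) * \<zeta>) = (\<Sum>\<beta>\<in>b ` space M. exp (of_real \<beta> * \<zeta>) * (f x * indicator (level M b \<beta>) x))"
  proof (cases "x \<in> space M")
    case True
    have "(\<Sum>\<beta>\<in>b ` space M. exp (of_real \<beta> * \<zeta>) * (f x * indicator (level M b \<beta>) x))
       = (\<Sum>\<beta>\<in>b ` space M. if \<beta> = b x then exp (of_real \<beta> * \<zeta>) * f x else 0)"
      using True by (intro sum.cong refl) (auto simp: level_def indicator_def)
    also have "\<dots> = exp (of_real (b x) * \<zeta>) * f x"
      using True simple_functionD(1)[OF b] by (subst sum.delta) auto
    finally show ?thesis by (simp add: mult.commute)
  qed (simp add: simple_fns_outside[OF f])
qed

lemma level_sets: "simple_function M b \<Longrightarrow> level M b \<beta> \<in> sets M"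
  using simple_functionD(2)[of M b "{\<beta>}"] by (simp add: level_def vimage_def Int_def conj_commute)

lemma simple_fns_exp:
  assumes f: "f \<in> simple_fns M" and b: "simple_function M b"
  shows "(\<lambda>x. f x * exp (of_real (b x) * \<zeta>)) \<in> simple_fns M"
  unfolding simple_fns_exp_decomp[OF assms]
  by (intro simple_fns_sum simple_fns_restrict f level_sets b)

lemma simple_tuples_upd:
  "f \<in> simple_tuples m M \<Longrightarrow> j \<in> {1..m} \<Longrightarrow> g \<in> simple_fns (M j) \<Longrightarrow> f(j := g) \<in> simple_tuples m M"
  by (auto simp: simple_tuples_def PiE_def extensional_def Pi_def)

lemma multilinear_op_sum:
  assumes T: "multilinear_op m M P T" and f: "f \<in> simple_tuples m M" and j: "j \<in> {1..m}"
    and I: "finite I" and g: "\<And>i. i \<in> I \<Longrightarrow> g i \<in> simple_fns (M j)" and z: "z \<in> space P"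
  shows "T (f(j := \<lambda>x. \<Sum>i\<in>I. a i * g i x)) z = (\<Sum>i\<in>I. a i * T (f(j := g i)) z)"
proof -
  have lin: "T (f(j := \<lambda>x. c * g x + d * h x)) z = c * T (f(j := g)) z + d * T (f(j := h)) z"
    if "g \<in> simple_fns (M j)" "h \<in> simple_fns (M j)" for c d g h
    using T f j z that unfolding multilinear_op_def by blast
  show ?thesis using I g
  proof (induction I rule: finite_induct)
    case empty
    have "T (f(j := \<lambda>x. 0)) z = 0" using lin[OF simple_fns_zero simple_fns_zero, of 0 0] by simp
    then show ?case by (simp only: sum.empty)
  next
    case (insert i I)
    have "T (f(j := \<lambda>x. \<Sum>i\<in>insert i I. a i * g i x)) z = T (f(j := \<lambda>x. a i * g i x + 1 * (\<Sum>i\<in>I. a i * g i x))) z"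
      using insert.hyps by simp
    also have "\<dots> = a i * T (f(j := g i)) z + 1 * T (f(j := \<lambda>x. \<Sum>i\<in>I. a i * g i x)) z"
      using insert.prems by (intro lin simple_fns_sum) auto
    also have "T (f(j := \<lambda>x. \<Sum>i\<in>I. a i * g i x)) z = (\<Sum>i\<in>I. a i * T (f(j := g i)) z)"
      using insert.prems by (intro insert.IH) auto
    also have "a i * T (f(j := g i)) z + 1 * \<dots> = (\<Sum>i\<in>insert i I. a i * T (f(j := g i)) z)"
      by (simp only: sum.insert[OF insert.hyps] mult_1_left)
    finally show ?case .
  qed
qed

definition exp_family :: "nat set \<Rightarrow> (nat \<Rightarrow> 'a \<Rightarrow> real) \<Rightarrow> (nat \<Rightarrow> 'a \<Rightarrow> complex) \<Rightarrow> complex \<Rightarrow> nat \<Rightarrow> 'a \<Rightarrow> complex" where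
  "exp_family J b f \<zeta> = (\<lambda>j. if j \<in> J then (\<lambda>x. f j x * exp (of_real (b j x) * \<zeta>)) else f j)"

lemma exp_family_simple:
  assumes "f \<in> simple_tuples m M" "\<And>j. j \<in> {1..m} \<Longrightarrow> simple_function (M j) (b j)" "J \<subseteq> {1..m}"
  shows "exp_family J b f \<zeta> \<in> simple_tuples m M"
  using assms unfolding exp_family_def simple_tuples_def PiE_def extensional_def 
  by (auto simp: Pi_def intro!: simple_fns_exp)

text \<open>
  Expanding one slot after the other by linearity exhibits the value of \<open>T\<close> as a finite sum of
  exponentials \<open>exp (\<beta> * (z - \<theta>))\<close> with real \<open>\<beta>\<close>; these are bounded on the strip.
\<close>

lemma strip_bounded_multilinear_exp_family:
  assumes T: "multilinear_op m M P T" and b: "\<And>j. j \<in> {1..m} \<Longrightarrow> simple_function (M j) (b j)"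
    and J: "J \<subseteq> {1..m}" and f: "f \<in> simple_tuples m M" and z: "xy \<in> space P"
  shows "strip_bounded (\<lambda>z. T (exp_family J b f (z - of_real \<theta>)) xy)"
proof -
  have "finite J" using J finite_subset by blast
  then show ?thesis using J f
  proof (induction J arbitrary: f rule: finite_induct)
    case empty
    then show ?case by (simp add: exp_family_def strip_bounded_const)
  next
    case (insert k J)
    have k: "k \<in> {1..m}" and J: "J \<subseteq> {1..m}" using insert.prems by auto
    have fk: "f k \<in> simple_fns (M k)" using insert.prems(2) k by (auto simp: simple_tuples_def)
    let ?B = "b k ` space (M k)"
    define fb where "fb \<beta> = (\<lambda>x. f k x * indicator (level (M k) (b k) \<beta>) x)" for \<beta>
    have fb: "fb \<beta> \<in> simple_fns (M k)" for \<beta>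
      unfolding fb_def by (intro simple_fns_restrict fk level_sets b k)
    have upd: "(exp_family J b f \<zeta>)(k := g) = exp_family J b (f(k := g)) \<zeta>" for g \<zeta>
      using insert.hyps by (auto simp: exp_family_def fun_eq_iff)
    have "T (exp_family (insert k J) b f (z - of_real \<theta>)) xy = 
      (\<Sum>\<beta>\<in>?B. exp (of_real \<beta> * (z - of_real \<theta>)) * T (exp_family J b (f(k := fb \<beta>)) (z - of_real \<theta>)) xy)" for z
    proof -
      let ?\<zeta> = "z - of_real \<theta>"
      have "exp_family (insert k J) b f ?\<zeta> = (exp_family J b f ?\<zeta>)(k := \<lambda>x. f k x * exp (of_real (b k x) * ?\<zeta>))"
        by (auto simp: exp_family_def fun_eq_iff)
      also have "\<dots> = (exp_family J b f ?\<zeta>)(k := \<lambda>x. \<Sum>\<beta>\<in>?B. exp (of_real \<beta> * ?\<zeta>) * fb \<beta> x)"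
        unfolding simple_fns_exp_decomp[OF fk b[OF k]] fb_def ..
      finally have eq: "exp_family (insert k J) b f ?\<zeta> = \<dots>" .
      have "T (exp_family (insert k J) b f ?\<zeta>) xy = (\<Sum>\<beta>\<in>?B. exp (of_real \<beta> * ?\<zeta>) * T ((exp_family J b f ?\<zeta>)(k := fb \<beta>)) xy)"
        unfolding eq using insert.prems(2) b J k fb z simple_functionD(1)[OF b[OF k]]
        by (intro multilinear_op_sum[OF T] exp_family_simple) auto
      then show ?thesis by (simp only: upd)
    qed
    moreover have "strip_bounded (\<lambda>z. \<Sum>\<beta>\<in>?B. exp (of_real \<beta> * (z - of_real \<theta>)) * T (exp_family J b (f(k := fb \<beta>)) (z - of_real \<theta>)) xy)"
      using insert.prems(2) k fb by (intro strip_bounded_sum strip_bounded_mult strip_bounded_exp insert.IH J simple_tuples_upd) auto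
    ultimately show ?case by simp
  qed
qed

text \<open>
  As \<open>b\<close> is real, the modulus of the exponential depends on \<open>Re \<zeta>\<close> only; hence norms are constant along
  vertical lines.
\<close>

lemma Lp_norm_exp_factor:
  "Lp_norm M p w (\<lambda>x. f x * exp (of_real (b x) * \<zeta>)) = Lp_norm M p w (\<lambda>x. f x * of_real (exp (Re \<zeta> * b x)))"
  by (simp add: Lp_norm_def norm_mult norm_exp_eq_Re mult.commute)

section \<open>Interpolation\<close>

theorem theorem3p5:
  fixes m :: nat
    and M :: "nat \<Rightarrow> 'a measure" and N :: "'b measure" and Nt :: "'c measure"
    and T :: "(nat \<Rightarrow> 'a \<Rightarrow> complex) \<Rightarrow> 'b \<times> 'c \<Rightarrow> complex"
    and pt0 qt0 rt0 p0 q0 r0 \<theta> M1 M2 :: real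
    and p q r :: "nat \<Rightarrow> ennreal"
    and w v u :: "nat \<Rightarrow> 'a \<Rightarrow> ennreal" and w0 v0 u0 :: "'b \<Rightarrow> ennreal"
  assumes "1 \<le> m"
    and "multilinear_op m M (N \<Otimes>\<^sub>M Nt) T"
    and "0 < pt0" "0 < qt0" "0 < p0" "0 < q0"
    and "\<And>j. j \<in> {1..m} \<Longrightarrow> 1 \<le> p j \<and> 1 \<le> q j"
    and "\<And>j. j \<in> {1..m} \<Longrightarrow> weight (M j) (w j) \<and> weight (M j) (v j)"
    and "weight N w0" "weight N v0"
    and "0 < M1" "0 < M2"
    and meas_p: "\<And>f. f \<in> simple_tuples m M \<Longrightarrow>
           (\<And>j. j \<in> {1..m} \<Longrightarrow> Lp_norm (M j) (p j) (w j) (f j) < \<infinity>) \<Longrightarrow>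
           inner_int Nt pt0 (T f) \<in> borel_measurable N"
    and bound_p: "\<And>f. f \<in> simple_tuples m M \<Longrightarrow>
           (\<And>j. j \<in> {1..m} \<Longrightarrow> Lp_norm (M j) (p j) (w j) (f j) < \<infinity>) \<Longrightarrow>
           mixed_norm N Nt p0 pt0 w0 (T f)
             \<le> ennreal M1 * (\<Prod>j=1..m. Lp_norm (M j) (p j) (w j) (f j))"
    and meas_q: "\<And>f. f \<in> simple_tuples m M \<Longrightarrow>
           (\<And>j. j \<in> {1..m} \<Longrightarrow> Lp_norm (M j) (q j) (v j) (f j) < \<infinity>) \<Longrightarrow>
           inner_int Nt qt0 (T f) \<in> borel_measurable N"
    and bound_q: "\<And>f. f \<in> simple_tuples m M \<Longrightarrow>
           (\<And>j. j \<in> {1..m} \<Longrightarrow> Lp_norm (M j) (q j) (v j) (f j) < \<infinity>) \<Longrightarrow>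
           mixed_norm N Nt q0 qt0 v0 (T f)
             \<le> ennreal M2 * (\<Prod>j=1..m. Lp_norm (M j) (q j) (v j) (f j))"
    and "0 < \<theta>" "\<theta> < 1"
    and "1 / rt0 = (1 - \<theta>) / pt0 + \<theta> / qt0"
    and "1 / r0 = (1 - \<theta>) / p0 + \<theta> / q0"
    and "\<And>j. j \<in> {1..m} \<Longrightarrow> 1 / r j = ennreal (1 - \<theta>) / p j + ennreal \<theta> / q j"
    and "\<And>x. x \<in> space N \<Longrightarrow> u0 x = epowr (w0 x) (1 - \<theta>) * epowr (v0 x) \<theta>"
    and "\<And>j x. j \<in> {1..m} \<Longrightarrow> x \<in> space (M j) \<Longrightarrow>
           u j x = epowr (w j x) (1 - \<theta>) * epowr (v j x) \<theta>"
  shows "\<forall>f \<in> simple_tuples m M.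
           (\<forall>j\<in>{1..m}. Lp_norm (M j) (p j) (w j) (f j) < \<infinity> \<and> Lp_norm (M j) (q j) (v j) (f j) < \<infinity>) \<longrightarrow>
           mixed_norm N Nt r0 rt0 u0 (T f)
             \<le> ennreal (M1 powr (1 - \<theta>) * M2 powr \<theta>) * (\<Prod>j=1..m. Lp_norm (M j) (r j) (u j) (f j))"
proof (intro ballI impI)
  fix f assume f: "f \<in> simple_tuples m M"
    and fin: "\<forall>j\<in>{1..m}. Lp_norm (M j) (p j) (w j) (f j) < \<infinity> \<and> Lp_norm (M j) (q j) (v j) (f j) < \<infinity>"
  note \<theta> = \<open>0 < \<theta>\<close> \<open>\<theta> < 1\<close>
  let ?c = "\<lambda>j. Lp_norm (M j) (r j) (u j) (f j)"
  have fj: "f j \<in> simple_fns (M j)" if "j \<in> {1..m}" for j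
    using f that by (auto simp: simple_tuples_def)
  have bal: "?c j < \<infinity> \<and> (\<exists>b. simple_function (M j) b \<and>
     Lp_norm (M j) (p j) (w j) (\<lambda>x. f j x * exp (- \<theta> * b x)) \<le> ?c j + ennreal \<eta> \<and>
     Lp_norm (M j) (q j) (v j) (\<lambda>x. f j x * exp ((1 - \<theta>) * b x)) \<le> ?c j + ennreal \<eta>)"
    if j: "j \<in> {1..m}" and \<eta>: "0 < \<eta>" for j \<eta>
    using balancing_exponent[OF \<theta>, of "p j" "q j" "r j" "M j" "w j" "v j" "u j" "f j" \<eta>] 
      assms(7)[OF j] assms(8)[OF j] assms(21)[OF j] assms(23)[OF j] fin j \<eta> simple_fns_measurable[OF fj[OF j]]
    by auto
  have fin_c: "?c j < \<infinity>" if "j \<in> {1..m}" for j using bal[OF that zero_less_one] by blast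
  have approx: "mixed_norm N Nt r0 rt0 u0 (T f) \<le> ennreal (M1 powr (1 - \<theta>) * M2 powr \<theta>) * (\<Prod>j=1..m. ?c j + ennreal \<eta>)"
    if \<eta>: "0 < \<eta>" for \<eta>
  proof -
    have "\<exists>b. \<forall>j\<in>{1..m}. simple_function (M j) (b j) \<and>
     Lp_norm (M j) (p j) (w j) (\<lambda>x. f j x * exp (- \<theta> * b j x)) \<le> ?c j + ennreal \<eta> \<and>
     Lp_norm (M j) (q j) (v j) (\<lambda>x. f j x * exp ((1 - \<theta>) * b j x)) \<le> ?c j + ennreal \<eta>"
      using bal[OF _ \<eta>] by (intro bchoice) blast
    then obtain b where b: "\<And>j. j \<in> {1..m} \<Longrightarrow> simple_function (M j) (b j)"
      and b0: "\<And>j. j \<in> {1..m} \<Longrightarrow> Lp_norm (M j) (p j) (w j) (\<lambda>x. f j x * exp (- \<theta> * b j x)) \<le> ?c j + ennreal \<eta>"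
      and b1: "\<And>j. j \<in> {1..m} \<Longrightarrow> Lp_norm (M j) (q j) (v j) (\<lambda>x. f j x * exp ((1 - \<theta>) * b j x)) \<le> ?c j + ennreal \<eta>"
      by blast
    \<comment> \<open>At \<open>z = \<theta>\<close> all exponentials are \<open>1\<close> and the family passes through \<open>f\<close>.\<close>
    define F where "F z = exp_family {1..m} b f (z - of_real \<theta>)" for z
    have F: "F z \<in> simple_tuples m M" for z
      unfolding F_def by (intro exp_family_simple f b) auto
    have F_\<theta>: "F \<theta> = f" by (auto simp: F_def exp_family_def)
    let ?\<Pi> = "\<Prod>j=1..m. ?c j + ennreal \<eta>"
    have c_fin: "?c j + ennreal \<eta> < \<infinity>" if "j \<in> {1..m}" for j using fin_c[OF that] by simp
    have F0: "Lp_norm (M j) (p j) (w j) (F z j) \<le> ?c j + ennreal \<eta>" if "Re z = 0" "j \<in> {1..m}" for z j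
      using b0[OF that(2)] that by (simp add: F_def exp_family_def Lp_norm_exp_factor)
    have F1: "Lp_norm (M j) (q j) (v j) (F z j) \<le> ?c j + ennreal \<eta>" if "Re z = 1" "j \<in> {1..m}" for z j
      using b1[OF that(2)] that by (simp add: F_def exp_family_def Lp_norm_exp_factor)
    have "mixed_norm N Nt r0 rt0 u0 (T (F \<theta>)) \<le> epowr (ennreal M1 * ?\<Pi>) (1 - \<theta>) * epowr (ennreal M2 * ?\<Pi>) \<theta>"
    proof (rule three_lines_mixed_norm[where G = "\<lambda>z. T (F z)"])
      show "w0 \<in> borel_measurable N" "v0 \<in> borel_measurable N" 
        using assms(9,10) by (auto simp: weight_def)
      show "strip_bounded (\<lambda>z. T (F z) xy)" if "xy \<in> space (N \<Otimes>\<^sub>M Nt)" for xy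
        unfolding F_def by (rule strip_bounded_multilinear_exp_family[OF assms(2) b subset_refl f that])
      show "T (F z) \<in> borel_measurable (N \<Otimes>\<^sub>M Nt)" for z
        using assms(2) F by (auto simp: multilinear_op_def)
      fix z :: complex
      {
        assume z: "Re z = 0"
        have f0: "Lp_norm (M j) (p j) (w j) (F z j) < \<infinity>" if "j \<in> {1..m}" for j
          using F0[OF z that] c_fin[OF that] by (rule le_less_trans)
        show "inner_int Nt pt0 (T (F z)) \<in> borel_measurable N"
          by (intro meas_p F f0)
        have "mixed_norm N Nt p0 pt0 w0 (T (F z)) \<le> ennreal M1 * (\<Prod>j=1..m. Lp_norm (M j) (p j) (w j) (F z j))"
          by (intro bound_p F f0)
        also have "\<dots> \<le> ennreal M1 * ?\<Pi>"
          by (intro mult_left_mono prod_mono_ennreal F0[OF z]) auto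
        finally show "mixed_norm N Nt p0 pt0 w0 (T (F z)) \<le> ennreal M1 * ?\<Pi>" .
      next
        assume z: "Re z = 1"
        have f1: "Lp_norm (M j) (q j) (v j) (F z j) < \<infinity>" if "j \<in> {1..m}" for j
          using F1[OF z that] c_fin[OF that] by (rule le_less_trans)
        show "inner_int Nt qt0 (T (F z)) \<in> borel_measurable N"
          by (intro meas_q F f1)
        have "mixed_norm N Nt q0 qt0 v0 (T (F z)) \<le> ennreal M2 * (\<Prod>j=1..m. Lp_norm (M j) (q j) (v j) (F z j))"
          by (intro bound_q F f1)
        also have "\<dots> \<le> ennreal M2 * ?\<Pi>"
          by (intro mult_left_mono prod_mono_ennreal F1[OF z]) auto
        finally show "mixed_norm N Nt q0 qt0 v0 (T (F z)) \<le> ennreal M2 * ?\<Pi>" .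
      }
    qed (use assms in auto)
    also have "\<dots> = epowr (ennreal M1) (1 - \<theta>) * epowr (ennreal M2) \<theta> * epowr ?\<Pi> ((1 - \<theta>) + \<theta>)"
      unfolding epowr_mult epowr_add by (simp only: mult_ac)
    also have "\<dots> = ennreal (M1 powr (1 - \<theta>) * M2 powr \<theta>) * ?\<Pi>"
      using assms(11,12) by (simp add: epowr_ennreal ennreal_mult)
    finally show ?thesis unfolding F_\<theta> .
  qed
  \<comment> \<open>All norms are finite, so letting \<open>\<eta>\<close> tend to \<open>0\<close> is a limit of real products.\<close>
  define c where "c j = enn2real (?c j)" for j
  have c: "?c j = ennreal (c j)" "0 \<le> c j" if "j \<in> {1..m}" for j
    using fin_c[OF that] by (simp_all add: c_def)
  let ?K = "M1 powr (1 - \<theta>) * M2 powr \<theta>"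
  have "((\<lambda>\<eta>. ennreal (?K * (\<Prod>j=1..m. c j + \<eta>))) \<longlongrightarrow> ennreal (?K * (\<Prod>j=1..m. c j + 0))) (at_right 0)"
    by (intro tendsto_ennrealI tendsto_intros)
  moreover have "\<forall>\<^sub>F \<eta> in at_right 0. mixed_norm N Nt r0 rt0 u0 (T f) \<le> ennreal (?K * (\<Prod>j=1..m. c j + \<eta>))"
    using eventually_at_right_less[of 0]
  proof eventually_elim
    case (elim \<eta>)
    have "(\<Prod>j=1..m. ?c j + ennreal \<eta>) = ennreal (\<Prod>j=1..m. c j + \<eta>)"
      using c elim by (subst prod_ennreal[symmetric]) (auto intro!: prod.cong simp: ennreal_plus)
    then show ?case using approx[OF elim] by (simp add: ennreal_mult')
  qed
  ultimately have "mixed_norm N Nt r0 rt0 u0 (T f) \<le> ennreal (?K * (\<Prod>j=1..m. c j + 0))"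
    by (intro tendsto_lowerbound) auto
  also have "\<dots> = ennreal ?K * (\<Prod>j=1..m. ?c j)"
  proof -
    have "(\<Prod>j=1..m. ?c j) = ennreal (\<Prod>j=1..m. c j)"
      using c by (subst prod_ennreal[symmetric]) (auto intro!: prod.cong)
    then show ?thesis by (simp add: ennreal_mult')
  qed
  finally show "mixed_norm N Nt r0 rt0 u0 (T f) \<le> ennreal ?K * (\<Prod>j=1..m. ?c j)" .
qed

end
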